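(* Let $n\ge1$, $L=\operatorname{diag}(x^1,\dots,x^n)$, $g_{\mathsf{LC}}=\sum_{s=1}^n\bigl(\prod_{j\ne s}(x^s-x^j)\bigr)^{-1}(\partial/\partial x^s)^2$, and let $P(t)=-4c\,(t-\mu_1)^{k_1}\cdots(t-\mu_m)^{k_m}$ with $c\neq0$, pairwise distinct (possibly complex) $\mu_i$, and $d:=n-(k_1+\dots+k_m)\ge0$. Consider the flat contravariant metric $g=P(L)g_{\mathsf{LC}}$, i.e. $g^{ss}=P(x^s)/\prod_{j\neq s}(x^s-x^j)$. Define, using any local branch of the square root, $Y_i^\alpha=\frac{1}{\alpha!}\frac{d^\alpha}{dt^\alpha}\sqrt{\det(t\operatorname{Id}-L)}\Big|_{t=\mu_i}$ for $i=1,\dots,m$, $\alpha=0,\dots,k_i-1$, and $Y_\infty^\alpha=\frac{1}{\alpha!}\frac{d^\alpha}{dt^\alpha}\sqrt{\det(\operatorname{Id}-tL)}\Big|_{t=0}-R^{(\alpha)}$ for $\alpha=1,\dots,d$, where $R^{(\alpha)}=\frac{1}{\alpha!}\frac{d^\alpha}{dt^\alpha}\prod_{i=1}^m(1-t\mu_i)^{k_i}\Big|_{t=0}$. Then each of these $n$ functions $Y$ satisfies $\nabla\nabla Y=0$ ($\nabla$ the Levi-Civita connection of $g$), and they are independent, so they form flat coordinates for $g$. More precisely, with $\tilde P_i(t)=\prod_{s\neq i}(t-\mu_s)^{k_s}$, $\tilde P_i^{(k)}=\frac1{k!}\frac{d^k}{dt^k}\tilde P_i(t)|_{t=\mu_i}$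 (and $\tilde P_i^{(k)}=0$, $R^{(k)}=0$ for $k<0$): $g^*(dY_i^\alpha,dY_j^\beta)=0$ for $i\ne j$; $g^*(dY_i^\alpha,dY_i^\beta)=c\,\tilde P_i^{(\alpha+\beta-k_i+1)}$; $g^*(dY_i^\alpha,dY_\infty^\beta)=0$; $g^*(dY_\infty^\alpha,dY_\infty^\beta)=-c\,R^{(\alpha+\beta-d-1)}$, and the resulting constant $n\times n$ matrix is nondegenerate.
   Context: $g^*$ denotes the contravariant metric applied to covectors. A function $Y$ with $\nabla\nabla Y=0$ has covariantly constant differential; flat coordinates are $n$ functionally independent such functions. *)

theory Defs
  imports "HOL-Analysis.Analysis"
begin

text \<open>Coordinates x = (x^1,...,x^n) are the components of a point x :: complex^'n,
  n = CARD('n). All objects are complex (holomorphic) since the mu_i may be complex.\<close>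

definition partial :: "'n::finite \<Rightarrow> (complex^'n \<Rightarrow> complex) \<Rightarrow> complex^'n \<Rightarrow> complex" where
  "partial s f x = frechet_derivative f (at x) (axis s 1)"

definition Lmat :: "complex^'n \<Rightarrow> complex^'n^'n" where
  "Lmat x = (\<chi> i j. if i = j then x $ i else 0)"

definition Ppoly :: "complex \<Rightarrow> (nat \<Rightarrow> complex) \<Rightarrow> (nat \<Rightarrow> nat) \<Rightarrow> nat \<Rightarrow> complex \<Rightarrow> complex" where
  "Ppoly c mu k m t = -4 * c * (\<Prod>i<m. (t - mu i) ^ k i)"

definition ginv :: "(complex \<Rightarrow> complex) \<Rightarrow> complex^'n \<Rightarrow> 'n::finite \<Rightarrow> 'n \<Rightarrow> complex" where
  "ginv P x a b = (if a = b then P (x $ a) / (\<Prod>j\<in>UNIV - {a}. (x $ a - x $ j)) else 0)"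

definition gcov :: "(complex \<Rightarrow> complex) \<Rightarrow> complex^'n \<Rightarrow> 'n::finite \<Rightarrow> 'n \<Rightarrow> complex" where
  "gcov P x a b = (if a = b then (\<Prod>j\<in>UNIV - {a}. (x $ a - x $ j)) / P (x $ a) else 0)"

definition christoffel :: "(complex \<Rightarrow> complex) \<Rightarrow> complex^'n \<Rightarrow> 'n::finite \<Rightarrow> 'n \<Rightarrow> 'n \<Rightarrow> complex" where
  "christoffel P x c a b = (1/2) * (\<Sum>e\<in>UNIV. ginv P x c e *
      (partial a (\<lambda>y. gcov P y b e) x + partial b (\<lambda>y. gcov P y a e) x
       - partial e (\<lambda>y. gcov P y a b) x))"

definition hess :: "(complex \<Rightarrow> complex) \<Rightarrow> (complex^'n \<Rightarrow> complex) \<Rightarrow> complex^'n \<Rightarrow> 'n::finite \<Rightarrow> 'n \<Rightarrow> complex" where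
  "hess P Y x a b = partial a (partial b Y) x - (\<Sum>c\<in>UNIV. christoffel P x c a b * partial c Y x)"

definition gstar :: "(complex \<Rightarrow> complex) \<Rightarrow> complex^'n \<Rightarrow> (complex^'n \<Rightarrow> complex) \<Rightarrow> (complex^'n \<Rightarrow> complex) \<Rightarrow> complex" where
  "gstar P x Y Z = (\<Sum>a\<in>(UNIV::'n::finite set). \<Sum>b\<in>UNIV. ginv P x a b * partial a Y x * partial b Z x)"

definition tcoef :: "(complex \<Rightarrow> complex) \<Rightarrow> complex \<Rightarrow> int \<Rightarrow> complex" where
  "tcoef f t0 j = (if j < 0 then 0 else (deriv ^^ nat j) f t0 / of_nat (fact (nat j)))"

definition Rco :: "(nat \<Rightarrow> complex) \<Rightarrow> (nat \<Rightarrow> nat) \<Rightarrow> nat \<Rightarrow> int \<Rightarrow> complex" where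
  "Rco mu k m j = tcoef (\<lambda>t. \<Prod>i<m. (1 - t * mu i) ^ k i) 0 j"

definition Ptil :: "(nat \<Rightarrow> complex) \<Rightarrow> (nat \<Rightarrow> nat) \<Rightarrow> nat \<Rightarrow> nat \<Rightarrow> int \<Rightarrow> complex" where
  "Ptil mu k m i j = tcoef (\<lambda>t. \<Prod>s\<in>{..<m} - {i}. (t - mu s) ^ k s) (mu i) j"

text \<open>Labels of the flat coordinates: Fin i alpha is Y_i^alpha, Inf alpha is Y_infty^alpha.\<close>
datatype fidx = Fin nat nat | Inf nat

definition fidx_set :: "(nat \<Rightarrow> nat) \<Rightarrow> nat \<Rightarrow> nat \<Rightarrow> fidx set" where
  "fidx_set k m d = {Fin i a | i a. i < m \<and> a < k i} \<union> {Inf a | a. 1 \<le> a \<and> a \<le> d}"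

text \<open>The functions Y, given local branches S i (t,x) of sqrt(det(t Id - L)) near t = mu_i
  and Sinf (t,x) of sqrt(det(Id - t L)) near t = 0.\<close>
fun Yfun :: "(nat \<Rightarrow> complex) \<Rightarrow> (nat \<Rightarrow> nat) \<Rightarrow> nat \<Rightarrow> (nat \<Rightarrow> complex \<Rightarrow> complex^'n \<Rightarrow> complex)
     \<Rightarrow> (complex \<Rightarrow> complex^'n \<Rightarrow> complex) \<Rightarrow> fidx \<Rightarrow> complex^'n \<Rightarrow> complex" where
  "Yfun mu k m S Sinf (Fin i a) x = (deriv ^^ a) (\<lambda>t. S i t x) (mu i) / of_nat (fact a)"
| "Yfun mu k m S Sinf (Inf a) x = (deriv ^^ a) (\<lambda>t. Sinf t x) 0 / of_nat (fact a) - Rco mu k m (int a)"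

fun Gram :: "complex \<Rightarrow> (nat \<Rightarrow> complex) \<Rightarrow> (nat \<Rightarrow> nat) \<Rightarrow> nat \<Rightarrow> nat \<Rightarrow> fidx \<Rightarrow> fidx \<Rightarrow> complex" where
  "Gram c mu k m d (Fin i a) (Fin j b) =
     (if i \<noteq> j then 0 else c * Ptil mu k m i (int a + int b - int (k i) + 1))"
| "Gram c mu k m d (Fin i a) (Inf b) = 0"
| "Gram c mu k m d (Inf a) (Fin j b) = 0"
| "Gram c mu k m d (Inf a) (Inf b) = - c * Rco mu k m (int a + int b - int d - 1)"

definition nondegenerate_on :: "'i set \<Rightarrow> ('i \<Rightarrow> 'i \<Rightarrow> complex) \<Rightarrow> bool" where
  "nondegenerate_on I G \<longleftrightarrow> (\<forall>v. (\<forall>b\<in>I. (\<Sum>a\<in>I. v a * G a b) = 0) \<longrightarrow> (\<forall>a\<in>I. v a = 0))"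

end

theory Submission
  imports Defs "HOL-Complex_Analysis.Complex_Analysis"
begin

text \<open>
  Put \<open>D(t) = \<Prod>\<^sub>s (t - x\<^sub>s)\<close>. Since \<open>\<partial>\<^sub>s \<surd>D(t) = - \<surd>D(t) / (2 (t - x\<^sub>s))\<close>, Lagrange interpolation of \<open>P\<close> at the
  \<open>x\<^sub>s\<close> gives
  \<open>4 (\<tau> - t) g\<^sup>*(d\<surd>D(t), d\<surd>D(\<tau>)) = P(t) \<surd>D(\<tau>) / \<surd>D(t) - P(\<tau>) \<surd>D(t) / \<surd>D(\<tau>)\<close>.
  As \<open>P\<close> vanishes to order \<open>k\<^sub>i\<close> at \<open>\<mu>\<^sub>i\<close> (and to order \<open>d\<close> at infinity, relative to degree \<open>n\<close>), the Taylor
  coefficients in question do not see \<open>\<surd>D\<close> and are constants. The resulting Gram matrix is block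
  anti-triangular, hence invertible, and functions with constant invertible Gram matrix are flat.
\<close>

text \<open>The branches are controlled only pointwise: for each \<open>x\<close> they are
  holomorphic in \<open>t\<close> on a ball depending on \<open>x\<close>, and in \<open>x\<close>
  only the value at the centre is known to be continuous. Hence \<open>d/dt\<close> and
  \<open>d/dx\<close> are never exchanged. The Taylor series in \<open>t\<close> is taken first, and
  the formal identity that its square is a product of factors affine in \<open>x\<close> governs how
  all coefficients vary with \<open>x\<close>.

  For two different expansion points \<open>\<tau> - t\<close> is a unit in the bivariate series
  ring, so orthogonality only needs both terms on the right to have high order. For a common point
  it is \<open>v - u\<close>, not a unit, and the quotient has to be exhibited; what remains is a
  divided difference of \<open>P\<close>, whose coefficients depend on
  \<open>\<alpha> + \<beta>\<close> only.

  The 4 in \<open>P\<close> compensates the two factors 1/2 from differentiating square roots. If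
  \<open>d = 0\<close>, then \<open>P\<close> has degree \<open>n\<close>, and interpolation at
  \<open>n\<close> nodes leaves a constant \<open>L\<close>, which cancels between \<open>t\<close>
  and \<open>\<tau>\<close>.\<close>

unbundle no Formal_Power_Series.fps_syntax

section \<open>Coefficientwise differentiation of formal power series\<close>

definition fps_has_derivative ::
  "('a::real_normed_vector \<Rightarrow> complex fps) \<Rightarrow> ('a \<Rightarrow> complex fps) \<Rightarrow> 'a \<Rightarrow> bool" where
  "fps_has_derivative F F' x \<longleftrightarrow>
     (\<forall>n. ((\<lambda>y. fps_nth (F y) n) has_derivative (\<lambda>h. fps_nth (F' h) n)) (at x))"

lemma fps_has_derivative_const: "fps_has_derivative (\<lambda>_. A) (\<lambda>_. 0) x"
  by (simp add: fps_has_derivative_def)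

lemma fps_has_derivative_mult:
  assumes "fps_has_derivative F F' x" "fps_has_derivative G G' x"
  shows "fps_has_derivative (\<lambda>y. F y * G y) (\<lambda>h. F x * G' h + F' h * G x) x"
  unfolding fps_has_derivative_def
proof
  fix n
  have F: "((\<lambda>y. fps_nth (F y) i) has_derivative (\<lambda>h. fps_nth (F' h) i)) (at x)"
    and G: "((\<lambda>y. fps_nth (G y) i) has_derivative (\<lambda>h. fps_nth (G' h) i)) (at x)" for i
    using assms by (auto simp: fps_has_derivative_def)
  show "((\<lambda>y. fps_nth (F y * G y) n) has_derivative
      (\<lambda>h. fps_nth (F x * G' h + F' h * G x) n)) (at x)"
    unfolding fps_mult_nth fps_add_nth sum.distrib[symmetric]
    by (intro has_derivative_sum has_derivative_mult F G)
qed

lemma fps_has_derivative_affine: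
  "fps_has_derivative (\<lambda>y::complex^'n. A + fps_const (y $ s) * B) (\<lambda>h. fps_const (h $ s) * B) x"
  unfolding fps_has_derivative_def
proof
  fix n
  have "bounded_linear (\<lambda>y::complex^'n. y $ s)"
    by (rule bounded_linear_vec_nth)
  then have "((\<lambda>y::complex^'n. y $ s) has_derivative (\<lambda>h. h $ s)) (at x)"
    by (rule bounded_linear_imp_has_derivative)
  from has_derivative_add[OF has_derivative_const has_derivative_mult_left[OF this]]
  show "((\<lambda>y::complex^'n. fps_nth (A + fps_const (y $ s) * B) n) has_derivative
      (\<lambda>h. fps_nth (fps_const (h $ s) * B) n)) (at x)"
    by simp
qed

lemma fps_has_derivative_prod:
  assumes "finite I" "\<And>i. i \<in> I \<Longrightarrow> fps_has_derivative (F i) (F' i) x"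
  shows "fps_has_derivative (\<lambda>y. \<Prod>i\<in>I. F i y) (\<lambda>h. \<Sum>i\<in>I. F' i h * (\<Prod>j\<in>I - {i}. F j x)) x"
  using assms
proof (induction I rule: finite_induct)
  case empty
  then show ?case by (simp add: fps_has_derivative_const)
next
  case (insert i I)
  have *: "(\<Sum>l\<in>I. F' l h * (\<Prod>j\<in>insert i I - {l}. F j x))
      = F i x * (\<Sum>l\<in>I. F' l h * (\<Prod>j\<in>I - {l}. F j x))" for h
    unfolding sum_distrib_left
  proof (rule sum.cong)
    fix l assume l: "l \<in> I"
    then have "insert i I - {l} = insert i (I - {l})" using insert by auto
    then show "F' l h * (\<Prod>j\<in>insert i I - {l}. F j x) = F i x * (F' l h * (\<Prod>j\<in>I - {l}. F j x))"
      using insert by simp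
  qed simp
  have "fps_has_derivative (\<lambda>y. F i y * (\<Prod>j\<in>I. F j y))
     (\<lambda>h. F i x * (\<Sum>l\<in>I. F' l h * (\<Prod>j\<in>I - {l}. F j x)) + F' i h * (\<Prod>j\<in>I. F j x)) x"
    by (intro fps_has_derivative_mult insert) auto
  then show ?case using insert * by (simp add: add.commute)
qed

lemma fps_has_derivative_unique:
  assumes "fps_has_derivative F F' x" "fps_has_derivative F G' x"
  shows "F' h = G' h"
proof (rule fps_ext)
  fix n
  have "(\<lambda>h. fps_nth (F' h) n) = (\<lambda>h. fps_nth (G' h) n)"
    using assms unfolding fps_has_derivative_def by (blast intro: has_derivative_unique)
  then show "fps_nth (F' h) n = fps_nth (G' h) n" by metis
qed

lemma fps_has_derivative_transform:
  assumes "fps_has_derivative F F' x" "open U" "x \<in> U" "\<And>y. y \<in> U \<Longrightarrow> F y = G y"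
  shows "fps_has_derivative G F' x"
  unfolding fps_has_derivative_def
proof
  fix n
  have "((\<lambda>y. fps_nth (F y) n) has_derivative (\<lambda>h. fps_nth (F' h) n)) (at x)"
    using assms by (auto simp: fps_has_derivative_def)
  then show "((\<lambda>y. fps_nth (G y) n) has_derivative (\<lambda>h. fps_nth (F' h) n)) (at x)"
    by (rule has_derivative_transform_within_open[OF _ assms(2,3)]) (simp add: assms(4))
qed

lemma fps_has_derivativeI:
  assumes "\<And>n. (\<lambda>y. fps_nth (F y) n) differentiable (at x)"
  shows "\<exists>F'. fps_has_derivative F F' x"
proof -
  obtain f' where "\<And>n. ((\<lambda>y. fps_nth (F y) n) has_derivative f' n) (at x)"
    using assms unfolding differentiable_def by metis
  then have "fps_has_derivative F (\<lambda>h. Abs_fps (\<lambda>n. f' n h)) x"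
    by (simp add: fps_has_derivative_def)
  then show ?thesis by blast
qed

lemma fps_has_derivative_differentiable:
  "fps_has_derivative F F' x \<Longrightarrow> (\<lambda>y. fps_nth (F y) n) differentiable (at x)"
  unfolding fps_has_derivative_def differentiable_def by blast

text \<open>Two stages: the recursion for the coefficients of an inverse yields that some derivative
  exists, and the product rule for \<open>inverse (F y) * F y = 1\<close> then forces its
  value.\<close>

lemma fps_has_derivative_inverse:
  assumes F: "fps_has_derivative F F' x" and U: "open U" "x \<in> U"
    and nz: "\<And>y. y \<in> U \<Longrightarrow> fps_nth (F y) 0 \<noteq> 0"
  shows "fps_has_derivative (\<lambda>y. inverse (F y)) (\<lambda>h. - F' h * inverse (F x) ^ 2) x"
proof -
  have dF: "(\<lambda>y. fps_nth (F y) n) differentiable (at x)" for n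
    using F by (rule fps_has_derivative_differentiable)
  have "(\<lambda>y. fps_nth (inverse (F y)) n) differentiable (at x)" for n
  proof (induction n rule: less_induct)
    case (less n)
    show ?case
    proof (cases n)
      case 0
      then show ?thesis using nz[OF U(2)] dF[of 0] 
        by (simp add: fps_inverse_def differentiable_inverse)
    next
      case (Suc k)
      have "fps_nth (inverse (F y)) n
          = - inverse (fps_nth (F y) 0) * (\<Sum>i=1..n. fps_nth (F y) i * fps_nth (inverse (F y)) (n - i))" for y
        using Suc by (simp add: fps_inverse_def)
      then show ?thesis
        using nz[OF U(2)] by (auto intro!: derivative_intros dF less)
    qed
  qed
  from fps_has_derivativeI[OF this]
  obtain R' where R': "fps_has_derivative (\<lambda>y. inverse (F y)) R' x" by blast
  have inv: "inverse (F y) * F y = 1" if "y \<in> U" for y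
    using nz[OF that] by (rule inverse_mult_eq_1)
  have "fps_has_derivative (\<lambda>_. 1) (\<lambda>h. inverse (F x) * F' h + R' h * F x) x"
    by (rule fps_has_derivative_transform[OF fps_has_derivative_mult[OF R' F] U]) (rule inv)
  then have *: "inverse (F x) * F' h + R' h * F x = 0" for h
    by (rule fps_has_derivative_unique[OF _ fps_has_derivative_const])
  have "R' h = - F' h * inverse (F x) ^ 2" for h
  proof -
    have "R' h = R' h * F x * inverse (F x)" using inv[OF U(2)] by (simp add: mult.assoc mult.commute)
    also have "R' h * F x = - inverse (F x) * F' h" using *[of h] by (simp add: eq_neg_iff_add_eq_0 add.commute)
    finally show ?thesis by (simp add: power2_eq_square algebra_simps)
  qed
  then have "R' = (\<lambda>h. - F' h * inverse (F x) ^ 2)" by blast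
  with R' show ?thesis by simp
qed

text \<open>Continuity pins the branch: near \<open>x\<close> the ratio \<open>f y / f x\<close> has
  positive real part, so it is the principal root of \<open>D y / D x\<close>. That quotient is 1 at
  \<open>y = x\<close>, away from the cut of \<open>csqrt\<close>.\<close>

lemma differentiable_sqrt_branch:
  fixes f D :: "'a::real_normed_vector \<Rightarrow> complex"
  assumes U: "open U" "x \<in> U" and f: "continuous_on U f" "\<And>y. y \<in> U \<Longrightarrow> f y ^ 2 = D y"
    and D: "D differentiable (at x)" "D x \<noteq> 0"
  shows "f differentiable (at x)"
proof -
  have fx: "f x \<noteq> 0" using D f(2)[OF U(2)] by auto
  have "continuous_on U (\<lambda>y. Re (f y / f x))"
    using f(1) fx by (intro continuous_intros) auto
  then have "open (U \<inter> (\<lambda>y. Re (f y / f x)) -` {0<..})"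
    using U(1) by (metis continuous_on_open_vimage open_greaterThan Int_commute)
  moreover have "x \<in> U \<inter> (\<lambda>y. Re (f y / f x)) -` {0<..}" using U fx by simp
  moreover have "f x * csqrt (D y / D x) = f y" if "y \<in> U \<inter> (\<lambda>y. Re (f y / f x)) -` {0<..}" for y
  proof -
    have "D y / D x = (f y / f x) ^ 2" using that f(2) U(2) by (simp add: power_divide)
    then have "csqrt (D y / D x) = f y / f x"
      using that by (simp add: csqrt_square)
    then show ?thesis using fx by simp
  qed
  moreover have "(\<lambda>y. f x * csqrt (D y / D x)) differentiable (at x)"
  proof -
    obtain D' where "(D has_derivative D') (at x)" using D by (auto simp: differentiable_def)
    then have d: "((\<lambda>y. D y / D x) has_derivative (\<lambda>h. D' h / D x)) (at x)"
      unfolding divide_inverse by (rule has_derivative_mult_left)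
    have "(csqrt has_field_derivative inverse (2 * csqrt (D x / D x))) (at (D x / D x))"
      using D(2) by (intro has_field_derivative_csqrt) (auto simp: complex_nonpos_Reals_iff)
    from has_derivative_compose[OF d has_field_derivative_imp_has_derivative[OF this]]
    show ?thesis unfolding differentiable_def by (intro exI) (rule has_derivative_mult_right)
  qed
  ultimately show ?thesis
    unfolding differentiable_def by (meson has_derivative_transform_within_open)
qed

text \<open>The coefficients of a formal square root satisfy a recursion, so they inherit
  differentiability from the constant coefficient.\<close>

lemma fps_has_derivative_sqrt:
  fixes F D :: "'a::real_normed_vector \<Rightarrow> complex fps"
  assumes U: "open U" "x \<in> U"
    and F: "continuous_on U (\<lambda>y. fps_nth (F y) 0)" "\<And>y. y \<in> U \<Longrightarrow> F y ^ 2 = D y"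
    and D: "fps_has_derivative D D' x" "fps_nth (D x) 0 \<noteq> 0"
  shows "fps_has_derivative F (\<lambda>h. fps_const (1/2) * D' h * inverse (F x)) x"
proof -
  have dD: "(\<lambda>y. fps_nth (D y) n) differentiable (at x)" for n
    using D(1) by (rule fps_has_derivative_differentiable)
  have F0: "fps_nth (F y) 0 ^ 2 = fps_nth (D y) 0" if "y \<in> U" for y
    using F(2)[OF that] by (metis fps_power_zeroth)
  have d0: "(\<lambda>y. fps_nth (F y) 0) differentiable (at x)"
    by (rule differentiable_sqrt_branch[OF U F(1) F0 dD D(2)])
  have Fx0: "fps_nth (F x) 0 \<noteq> 0" using F0[OF U(2)] D(2) by auto
  from F(1) have "open (U \<inter> (\<lambda>y. fps_nth (F y) 0) -` (- {0}))"
    using U(1) by (metis continuous_on_open_vimage open_Compl closed_singleton Int_commute)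
  then obtain V where V: "open V" "x \<in> V" "V \<subseteq> U" "\<And>y. y \<in> V \<Longrightarrow> fps_nth (F y) 0 \<noteq> 0"
    using Fx0 U(2) that[of "U \<inter> (\<lambda>y. fps_nth (F y) 0) -` (- {0})"] by auto
  have "(\<lambda>y. fps_nth (F y) n) differentiable (at x)" for n
  proof (induction n rule: less_induct)
    case (less n)
    show ?case
    proof (cases "n = 0")
      case True
      then show ?thesis using d0 by simp
    next
      case False
      \<comment> \<open>In the \<open>n\<close>-th coefficient of \<open>F y ^ 2 = D y\<close> the
        unknown occurs only as \<open>2 * F_0 * F_n\<close>; all other terms have smaller index. On
        \<open>V\<close> the factor \<open>F_0\<close> can be divided out.\<close>
      have eq: "(fps_nth (D y) n - (\<Sum>i\<in>{0<..<n}. fps_nth (F y) i * fps_nth (F y) (n - i)))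
            / (2 * fps_nth (F y) 0) = fps_nth (F y) n" if "y \<in> V" for y
      proof -
        have "fps_nth (D y) n = (\<Sum>i=0..n. fps_nth (F y) i * fps_nth (F y) (n - i))"
          using F(2) V(3) that by (simp flip: fps_mult_nth power2_eq_square add: subset_iff)
        also have "{0..n} = insert 0 (insert n {0<..<n})" using False by auto
        finally show ?thesis using V(4)[OF that] False by (simp add: field_simps)
      qed
      have "(\<lambda>y. (fps_nth (D y) n - (\<Sum>i\<in>{0<..<n}. fps_nth (F y) i * fps_nth (F y) (n - i)))
            / (2 * fps_nth (F y) 0)) differentiable (at x)"
        using Fx0 False
        by (intro differentiable_divide differentiable_diff dD differentiable_sum) (auto intro!: differentiable_mult less)
      then show ?thesis
        unfolding differentiable_def
        by (blast intro: has_derivative_transform_within_open[OF _ V(1,2)] eq)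
    qed
  qed
  from fps_has_derivativeI[OF this] obtain F' where F': "fps_has_derivative F F' x" by blast
  have "fps_has_derivative D (\<lambda>h. F x * F' h + F' h * F x) x"
    by (rule fps_has_derivative_transform[OF fps_has_derivative_mult[OF F' F'] U])
      (simp add: F(2) flip: power2_eq_square)
  then have D': "D' h = F x * F' h + F' h * F x" for h
    by (rule fps_has_derivative_unique[OF D(1)])
  have "F' h = fps_const (1/2) * D' h * inverse (F x)" for h
  proof -
    have "fps_const (1/2) * D' h = fps_const (1/2) * fps_const 2 * (F' h * F x)"
      unfolding D' by (simp add: numeral_fps_const[symmetric] algebra_simps)
    then have "fps_const (1/2) * D' h * inverse (F x) = F' h * (inverse (F x) * F x)"
      by (simp add: algebra_simps)
    then show ?thesis using inverse_mult_eq_1[OF Fx0] by simp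
  qed
  then have "F' = (\<lambda>h. fps_const (1/2) * D' h * inverse (F x))" by blast
  with F' show ?thesis by simp
qed

section \<open>First and second partial derivatives of the Taylor coefficients\<close>

lemma partial_eq:
  assumes "(f has_derivative f') (at x)"
  shows "partial s f x = f' (axis s 1)"
  unfolding partial_def frechet_derivative_at[OF assms, symmetric] ..

lemma partial_cong_open:
  assumes "open U" "x \<in> U" "\<And>y. y \<in> U \<Longrightarrow> f y = g y" "g differentiable (at x)"
  shows "partial s f x = partial s g x"
proof -
  obtain g' where g': "(g has_derivative g') (at x)"
    using assms(4) by (auto simp: differentiable_def)
  then have "(f has_derivative g') (at x)"
    by (rule has_derivative_transform_within_open[OF _ assms(1,2)]) (simp add: assms(3))
  then show ?thesis by (simp only: partial_eq[OF g'] partial_eq)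
qed

text \<open>With \<open>(A, B) = (\<mu> + X, -1)\<close> and \<open>(A, B) = (1, -X)\<close> the series \<open>F\<close> is the Taylor expansion of
  \<open>\<surd>(det (t Id - L))\<close> at \<open>\<mu>\<close> and of \<open>\<surd>(det (Id - t L))\<close> at \<open>0\<close>.\<close>

locale fps_sqrt_branch =
  fixes A B :: "complex fps" and U :: "(complex^'n) set" and F :: "complex^'n \<Rightarrow> complex fps"
    and q :: "'n \<Rightarrow> complex^'n \<Rightarrow> complex fps"
  defines "q \<equiv> \<lambda>s y. A + fps_const (y $ s) * B"
  assumes open_U: "open U"
    and square: "y \<in> U \<Longrightarrow> F y ^ 2 = (\<Prod>s\<in>UNIV. q s y)"
    and factor_nz: "y \<in> U \<Longrightarrow> fps_nth (q s y) 0 \<noteq> 0"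
    and cont: "continuous_on U (\<lambda>y. fps_nth (F y) 0)"
begin

lemma const_term_nz:
  assumes "y \<in> U" shows "fps_nth (F y) 0 \<noteq> 0"
proof -
  have "fps_nth (\<Prod>s\<in>T. q s y) 0 \<noteq> 0" if "finite T" for T
    using that by (induction T rule: finite_induct) (auto simp: factor_nz[OF assms])
  then have "fps_nth (F y ^ 2) 0 \<noteq> 0" using square[OF assms] by simp
  then show ?thesis by (simp add: fps_power_zeroth)
qed

lemma factor_inverse: "y \<in> U \<Longrightarrow> inverse (q s y) * q s y = 1"
  by (rule inverse_mult_eq_1[OF factor_nz])

lemma prod_except_factor:
  assumes "x \<in> U"
  shows "(\<Prod>j\<in>UNIV - {s}. q j x) = F x ^ 2 * inverse (q s x)"
proof -
  have "F x ^ 2 = q s x * (\<Prod>j\<in>UNIV - {s}. q j x)"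
    unfolding square[OF assms] by (rule prod.remove) auto
  then have "F x ^ 2 * inverse (q s x) = (inverse (q s x) * q s x) * (\<Prod>j\<in>UNIV - {s}. q j x)"
    by (simp only: ac_simps)
  then show ?thesis using factor_inverse[OF assms] by simp
qed

text \<open>Formal logarithmic derivative: \<open>dF / F\<close> is half the sum of
  \<open>dq_s / q_s\<close>, because \<open>F ^ 2\<close> is the product of the
  \<open>q_s\<close>.\<close>

lemma has_derivative_branch:
  assumes "x \<in> U"
  shows "fps_has_derivative F
    (\<lambda>h. fps_const (1/2) * F x * B * (\<Sum>s\<in>UNIV. fps_const (h $ s) * inverse (q s x))) x"
proof -
  let ?D = "\<lambda>y. \<Prod>s\<in>UNIV. q s y"
  have D: "fps_has_derivative ?D (\<lambda>h. \<Sum>s\<in>UNIV. fps_const (h $ s) * B * (\<Prod>j\<in>UNIV - {s}. q j x)) x"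
    unfolding q_def by (intro fps_has_derivative_prod fps_has_derivative_affine) simp
  have nz: "fps_nth (?D x) 0 \<noteq> 0"
    using const_term_nz[OF assms] square[OF assms] by (metis fps_power_zeroth power_not_zero)
  note rest = prod_except_factor[OF assms]
  have F1: "F x ^ 2 * inverse (F x) = F x"
    using inverse_mult_eq_1[OF const_term_nz[OF assms]] by (simp add: power2_eq_square mult.assoc mult.commute)
  have "fps_const (1/2) * (\<Sum>s\<in>UNIV. fps_const (h $ s) * B * (\<Prod>j\<in>UNIV - {s}. q j x)) * inverse (F x)
      = fps_const (1/2) * F x * B * (\<Sum>s\<in>UNIV. fps_const (h $ s) * inverse (q s x))" for h
  proof -
    have "fps_const (1/2) * (\<Sum>s\<in>UNIV. fps_const (h $ s) * B * (\<Prod>j\<in>UNIV - {s}. q j x)) * inverse (F x)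
      = fps_const (1/2) * (F x ^ 2 * inverse (F x)) * B * (\<Sum>s\<in>UNIV. fps_const (h $ s) * inverse (q s x))"
      unfolding rest sum_distrib_left sum_distrib_right by (intro sum.cong refl) (simp only: ac_simps)
    then show ?thesis unfolding F1 .
  qed
  with fps_has_derivative_sqrt[OF open_U assms cont square D nz]
  show ?thesis by simp
qed

lemma sum_axis: "(\<Sum>s\<in>UNIV. fps_const ((axis b (1::complex) :: complex^'n) $ s) * f s) = f b"
proof -
  have "(\<Sum>s\<in>UNIV. fps_const ((axis b (1::complex) :: complex^'n) $ s) * f s)
      = (\<Sum>s\<in>UNIV. if s = b then f s else 0)"
    by (intro sum.cong) (auto simp: axis_def)
  then show ?thesis by simp
qed

text \<open>The shift \<open>r\<close> makes room for the constant subtracted from the coordinates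
  at infinity; derivatives do not see it.\<close>

lemma coeff_differentiable:
  assumes "x \<in> U" shows "(\<lambda>y. fps_nth (F y) n - r) differentiable (at x)"
  by (intro differentiable_diff differentiable_const
      fps_has_derivative_differentiable[OF has_derivative_branch[OF assms]])

lemma partial_coeff:
  assumes "x \<in> U"
  shows "partial b (\<lambda>y. fps_nth (F y) n - r) x = fps_nth (fps_const (1/2) * F x * B * inverse (q b x)) n"
proof -
  have "((\<lambda>y. fps_nth (F y) n - r) has_derivative (\<lambda>h. fps_nth (fps_const (1/2) * F x * B *
      (\<Sum>s\<in>UNIV. fps_const (h $ s) * inverse (q s x))) n - 0)) (at x)"
    using has_derivative_branch[OF assms] unfolding fps_has_derivative_def
    by (intro has_derivative_diff has_derivative_const) auto
  from partial_eq[OF this] show ?thesis unfolding sum_axis by simp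
qed

lemma has_derivative_gradient:
  assumes "x \<in> U"
  shows "fps_has_derivative (\<lambda>y. fps_const (1/2) * F y * B * inverse (q b y))
    (\<lambda>h. fps_const (1/2) * F x * B * (- (fps_const (h $ b) * B) * inverse (q b x) ^ 2)
      + (fps_const (1/2) * (fps_const (1/2) * F x * B * (\<Sum>s\<in>UNIV. fps_const (h $ s) * inverse (q s x))) * B)
        * inverse (q b x)) x"
proof -
  have q: "fps_has_derivative (q b) (\<lambda>h. fps_const (h $ b) * B) x"
    unfolding q_def by (rule fps_has_derivative_affine)
  have c: "fps_has_derivative (\<lambda>y. fps_const (1/2) * F y * B)
     (\<lambda>h. fps_const (1/2) * (fps_const (1/2) * F x * B * (\<Sum>s\<in>UNIV. fps_const (h $ s) * inverse (q s x))) * B) x"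
    using fps_has_derivative_mult[OF fps_has_derivative_mult[OF fps_has_derivative_const[of "fps_const (1/2)"]
        has_derivative_branch[OF assms]] fps_has_derivative_const[of B]]
    by simp
  from fps_has_derivative_mult[OF c fps_has_derivative_inverse[OF q open_U assms factor_nz]]
  show ?thesis .
qed

lemma partial_coeff_differentiable:
  assumes "x \<in> U"
  shows "partial b (\<lambda>y. fps_nth (F y) n - r) differentiable (at x)"
proof -
  have "(\<lambda>y. fps_nth (fps_const (1/2) * F y * B * inverse (q b y)) n) differentiable (at x)"
    by (rule fps_has_derivative_differentiable[OF has_derivative_gradient[OF assms]])
  then obtain f' where "((\<lambda>y. fps_nth (fps_const (1/2) * F y * B * inverse (q b y)) n) has_derivative f') (at x)"
    unfolding differentiable_def by blast
  then have "(partial b (\<lambda>y. fps_nth (F y) n - r) has_derivative f') (at x)"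
    by (rule has_derivative_transform_within_open[OF _ open_U assms]) (rule partial_coeff[symmetric])
  then show ?thesis unfolding differentiable_def by blast
qed

text \<open>For \<open>a \<noteq> b\<close> the factor \<open>inverse (q b y)\<close> does not vary
  in direction \<open>a\<close>, so only \<open>F\<close> is differentiated again. The result is
  visibly symmetric in \<open>a\<close> and \<open>b\<close>, which gives equality of mixed partials
  by inspection.\<close>

lemma partial_partial_coeff:
  assumes "x \<in> U" "a \<noteq> b"
  shows "partial a (partial b (\<lambda>y. fps_nth (F y) n - r)) x
    = fps_nth (fps_const (1/4) * F x * B ^ 2 * inverse (q a x) * inverse (q b x)) n"
proof -
  note g = has_derivative_gradient[OF assms(1), of b]
  have "partial a (partial b (\<lambda>y. fps_nth (F y) n - r)) x
      = partial a (\<lambda>y. fps_nth (fps_const (1/2) * F y * B * inverse (q b y)) n) x"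
    by (rule partial_cong_open[OF open_U assms(1) partial_coeff fps_has_derivative_differentiable[OF g]])
  also have "\<dots> = fps_nth (fps_const (1/2) * F x * B * (- (fps_const ((axis a 1 :: complex^'n) $ b) * B) * inverse (q b x) ^ 2)
      + (fps_const (1/2) * (fps_const (1/2) * F x * B *
          (\<Sum>s\<in>UNIV. fps_const ((axis a 1 :: complex^'n) $ s) * inverse (q s x))) * B) * inverse (q b x)) n"
    by (rule partial_eq) (use g in \<open>auto simp: fps_has_derivative_def\<close>)
  also have "fps_const (1/2) * F x * B * (- (fps_const ((axis a 1 :: complex^'n) $ b) * B) * inverse (q b x) ^ 2)
      + (fps_const (1/2) * (fps_const (1/2) * F x * B *
          (\<Sum>s\<in>UNIV. fps_const ((axis a 1 :: complex^'n) $ s) * inverse (q s x))) * B) * inverse (q b x)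
     = (fps_const (1/2) * fps_const (1/2)) * F x * B ^ 2 * inverse (q a x) * inverse (q b x)"
    unfolding sum_axis using assms(2) by (simp add: axis_def power2_eq_square ac_simps del: fps_const_mult)
  finally show ?thesis by simp
qed

lemma partial_coeff_commute:
  assumes "x \<in> U"
  shows "partial a (partial b (\<lambda>y. fps_nth (F y) n - r)) x = partial b (partial a (\<lambda>y. fps_nth (F y) n - r)) x"
proof (cases "a = b")
  case False
  with assms show ?thesis
    by (simp add: partial_partial_coeff mult.assoc mult.commute[of "inverse (q a x)"])
qed simp

end

section \<open>Bivariate series and partial fractions\<close>

text \<open>Bivariate series are series in \<open>v\<close> with coefficients in \<open>C[[u]]\<close>; \<open>fps_const F\<close> is \<open>F(u)\<close> and
  \<open>fps_lift F\<close> is \<open>F(v)\<close>.\<close>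

definition fps_lift :: "'a::comm_ring_1 fps \<Rightarrow> 'a fps fps" where
  "fps_lift F = Abs_fps (\<lambda>n. fps_const (fps_nth F n))"

lemma fps_lift_nth [simp]: "fps_nth (fps_lift F) n = fps_const (fps_nth F n)"
  by (simp add: fps_lift_def)

lemma fps_const_sum: "fps_const (\<Sum>i\<in>I. f i) = (\<Sum>i\<in>I. fps_const (f i :: 'a::comm_ring_1))"
  by (induction I rule: infinite_finite_induct) (simp_all flip: fps_const_add)

lemma fps_lift_add: "fps_lift (F + G) = fps_lift F + fps_lift G"
  by (rule fps_ext) simp

lemma fps_lift_diff: "fps_lift (F - G) = fps_lift F - fps_lift G"
  by (rule fps_ext) simp

lemma fps_lift_const: "fps_lift (fps_const c) = fps_const (fps_const c)"
  by (rule fps_ext) simp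

lemma fps_lift_0: "fps_lift 0 = 0" and fps_lift_1: "fps_lift 1 = 1"
  by (auto intro!: fps_ext)

lemma fps_lift_sum: "fps_lift (\<Sum>i\<in>I. F i) = (\<Sum>i\<in>I. fps_lift (F i))"
  by (induction I rule: infinite_finite_induct) (auto simp: fps_lift_add fps_lift_0)

lemma fps_lift_mult: "fps_lift (F * G) = fps_lift F * fps_lift G"
  by (rule fps_ext) (simp add: fps_mult_nth fps_const_sum)

lemma fps_lift_X: "fps_lift fps_X = fps_X"
  by (rule fps_ext) (simp add: fps_X_def)

lemma fps_lift_power: "fps_lift (F ^ n) = fps_lift F ^ n"
  by (induction n) (simp_all add: fps_lift_1 fps_lift_mult)

lemma coeff_X_power_lt:
  assumes "b < l" shows "fps_nth (fps_nth (fps_X ^ l * Z) b) a = 0"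
  using assms by (simp add: fps_X_power_mult_nth)

text \<open>This is \<open>(F(v) - F(u)) / (v - u)\<close>: the quotient of \<open>v^n - u^n\<close>
  by \<open>v - u\<close> is the sum of all \<open>u^a v^b\<close> with
  \<open>a + b + 1 = n\<close>. Its coefficients therefore form a Hankel matrix, as do the Gram
  blocks.\<close>

definition fps_divided_difference :: "'a::comm_ring_1 fps \<Rightarrow> 'a fps fps" where
  "fps_divided_difference F = Abs_fps (\<lambda>b. Abs_fps (\<lambda>a. fps_nth F (a + b + 1)))"

lemma fps_divided_difference:
  fixes F :: "'a::comm_ring_1 fps"
  shows "(fps_X - fps_const fps_X) * fps_divided_difference F = fps_lift F - fps_const F"
proof (intro fps_ext)
  fix b a
  show "fps_nth (fps_nth ((fps_X - fps_const fps_X) * fps_divided_difference F) b) a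
      = fps_nth (fps_nth (fps_lift F - fps_const F) b) a"
    by (cases a; cases b) (simp_all add: fps_divided_difference_def left_diff_distrib)
qed

lemma coeff_fps_divided_difference:
  "fps_nth (fps_nth (fps_divided_difference F) b) a = fps_nth F (a + b + 1)"
  by (simp add: fps_divided_difference_def)

text \<open>All Gram identities are instances, with \<open>b s\<close> and \<open>b' s\<close> standing for \<open>1 / (t - x\<^sub>s)\<close> up to a factor and
  \<open>D\<close> for \<open>\<tau> - t\<close>; at infinity the local parameter is \<open>1 / t\<close>.\<close>

lemma partial_fraction_sum:
  fixes F G f g :: "complex fps" and a a' b b' :: "'s \<Rightarrow> complex fps" and w :: "'s \<Rightarrow> complex"
  assumes F0: "fps_nth F 0 \<noteq> 0" and G0: "fps_nth G 0 \<noteq> 0"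
    and split: "\<And>s. s \<in> I \<Longrightarrow> fps_const (a s) - fps_lift (a' s) = D * fps_const (b s) * fps_lift (b' s)"
    and a: "(\<Sum>s\<in>I. fps_const (w s) * a s) = f * inverse F ^ 2 - L"
    and a': "(\<Sum>s\<in>I. fps_const (w s) * a' s) = g * inverse G ^ 2 - L"
    and L: "fps_lift L = fps_const L"
  shows "D * (\<Sum>s\<in>I. fps_const (fps_const (w s)) * (fps_const (F * b s) * fps_lift (G * b' s)))
    = fps_const (f * inverse F) * fps_lift G - fps_const F * fps_lift (g * inverse G)"
proof -
  have "D * (\<Sum>s\<in>I. fps_const (fps_const (w s)) * (fps_const (F * b s) * fps_lift (G * b' s)))
     = fps_const F * fps_lift G * (\<Sum>s\<in>I. fps_const (fps_const (w s)) * (D * fps_const (b s) * fps_lift (b' s)))"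
    unfolding sum_distrib_left
    by (intro sum.cong refl) (simp add: fps_lift_mult fps_const_mult[symmetric] mult_ac del: fps_const_mult)
  also have "(\<Sum>s\<in>I. fps_const (fps_const (w s)) * (D * fps_const (b s) * fps_lift (b' s)))
     = (\<Sum>s\<in>I. fps_const (fps_const (w s)) * (fps_const (a s) - fps_lift (a' s)))"
    by (intro sum.cong refl) (simp add: split)
  also have "\<dots> = fps_const (\<Sum>s\<in>I. fps_const (w s) * a s) - fps_lift (\<Sum>s\<in>I. fps_const (w s) * a' s)"
    by (simp add: fps_const_sum fps_lift_sum fps_lift_mult fps_lift_const sum_subtractf right_diff_distrib)
  \<comment> \<open>The polynomial part \<open>L\<close> is the same series in \<open>u\<close> and
    in \<open>v\<close>, so it drops out of the difference.\<close>
  also have "\<dots> = fps_const (f * inverse F ^ 2) - fps_lift (g * inverse G ^ 2)"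
    unfolding a a' by (simp add: fps_lift_diff L flip: fps_const_sub)
  also have "fps_const F * fps_lift G * \<dots>
     = fps_const (f * inverse F * (inverse F * F)) * fps_lift G
       - fps_const F * fps_lift (g * inverse G * (inverse G * G))"
    by (simp add: fps_lift_mult power2_eq_square right_diff_distrib mult_ac
        del: fps_const_mult flip: fps_const_mult)
  finally show ?thesis
    using inverse_mult_eq_1[OF F0] inverse_mult_eq_1[OF G0] by simp
qed

text \<open>Modulo the ideal \<open>(u^k, v^l)\<close> the unit \<open>D\<close> can be cancelled.
  Concretely, a coefficient of \<open>D * M\<close> is the constant term of \<open>D\<close> times
  the same coefficient of \<open>M\<close>, plus terms with coefficients of \<open>M\<close> of
  smaller total degree.\<close>

lemma fps_fps_coeff_zero_cancel:
  fixes M D :: "complex fps fps"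
  assumes D: "fps_nth (fps_nth D 0) 0 \<noteq> 0"
    and DM: "\<And>\<alpha> \<beta>. \<alpha> < k \<Longrightarrow> \<beta> < l \<Longrightarrow> fps_nth (fps_nth (D * M) \<beta>) \<alpha> = 0"
    and "\<alpha> < k" "\<beta> < l"
  shows "fps_nth (fps_nth M \<beta>) \<alpha> = 0"
  using \<open>\<alpha> < k\<close> \<open>\<beta> < l\<close>
proof (induction "\<alpha> + \<beta>" arbitrary: \<alpha> \<beta> rule: less_induct)
  case less
  have "fps_nth (fps_nth (D * M) \<beta>) \<alpha>
      = (\<Sum>j=0..\<beta>. \<Sum>i=0..\<alpha>. fps_nth (fps_nth D j) i * fps_nth (fps_nth M (\<beta> - j)) (\<alpha> - i))"
    by (simp add: fps_mult_nth fps_sum_nth)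
  also have "\<dots> = (\<Sum>j=0..\<beta>. \<Sum>i=0..\<alpha>. if j = 0 \<and> i = 0 then fps_nth (fps_nth D 0) 0 * fps_nth (fps_nth M \<beta>) \<alpha> else 0)"
  proof (intro sum.cong refl)
    fix i j assume "j \<in> {0..\<beta>}" "i \<in> {0..\<alpha>}"
    then have "fps_nth (fps_nth M (\<beta> - j)) (\<alpha> - i) = 0" if "j \<noteq> 0 \<or> i \<noteq> 0"
      using that less.prems by (intro less.hyps) auto
    then show "fps_nth (fps_nth D j) i * fps_nth (fps_nth M (\<beta> - j)) (\<alpha> - i) =
      (if j = 0 \<and> i = 0 then fps_nth (fps_nth D 0) 0 * fps_nth (fps_nth M \<beta>) \<alpha> else 0)" by auto
  qed
  also have "\<dots> = (\<Sum>j=0..\<beta>. if j = 0 then fps_nth (fps_nth D 0) 0 * fps_nth (fps_nth M \<beta>) \<alpha> else 0)"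
    by (intro sum.cong refl) auto
  also have "\<dots> = fps_nth (fps_nth D 0) 0 * fps_nth (fps_nth M \<beta>) \<alpha>" by simp
  finally show ?case using DM[OF less.prems] D by simp
qed

lemma coeff_weighted_sum:
  "fps_nth (fps_nth (\<Sum>s\<in>I. fps_const (fps_const (w s)) * (fps_const (f s) * fps_lift (g s))) \<beta>) \<alpha>
    = (\<Sum>s\<in>I. w s * fps_nth (f s) \<alpha> * fps_nth (g s) \<beta>)"
  by (simp add: fps_sum_nth mult.assoc)

text \<open>Both terms of the partial fraction identity lie in \<open>(u^k, v^l)\<close>, and
  \<open>D\<close> is a unit, so the sum itself has no coefficient in the box below
  \<open>(k, l)\<close>.\<close>

lemma partial_fraction_cross_coeff:
  fixes F G p r L :: "complex fps" and a a' b b' :: "'s \<Rightarrow> complex fps" and w :: "'s \<Rightarrow> complex"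
  assumes F0: "fps_nth F 0 \<noteq> 0" and G0: "fps_nth G 0 \<noteq> 0"
    and split: "\<And>s. s \<in> I \<Longrightarrow> fps_const (a s) - fps_lift (a' s) = D * fps_const (b s) * fps_lift (b' s)"
    and a: "(\<Sum>s\<in>I. fps_const (w s) * a s) = fps_X ^ k * p * inverse F ^ 2 - L"
    and a': "(\<Sum>s\<in>I. fps_const (w s) * a' s) = fps_X ^ l * r * inverse G ^ 2 - L"
    and L: "fps_lift L = fps_const L"
    and D: "fps_nth (fps_nth D 0) 0 \<noteq> 0"
    and \<alpha>: "\<alpha> < k" and \<beta>: "\<beta> < l"
  shows "(\<Sum>s\<in>I. w s * fps_nth (F * b s) \<alpha> * fps_nth (G * b' s) \<beta>) = 0"
proof -
  define M where "M = (\<Sum>s\<in>I. fps_const (fps_const (w s)) * (fps_const (F * b s) * fps_lift (G * b' s)))"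
  have "D * M = fps_const (fps_X ^ k * p * inverse F) * fps_lift G
      - fps_const F * fps_lift (fps_X ^ l * r * inverse G)"
    unfolding M_def by (rule partial_fraction_sum[OF F0 G0 split a a' L])
  then have "fps_nth (fps_nth (D * M) \<beta>) \<alpha> = 0" if "\<alpha> < k" "\<beta> < l" for \<alpha> \<beta>
    using that by (simp add: mult.assoc fps_X_power_mult_nth)
  from fps_fps_coeff_zero_cancel[OF D this \<alpha> \<beta>]
  show ?thesis unfolding M_def coeff_weighted_sum .
qed

text \<open>Here \<open>D\<close> is a multiple of \<open>v - u\<close> and must be divided out
  exactly. The quotient is a divided difference of \<open>fps_X ^ k * p\<close> plus a divided
  difference of \<open>F\<close> multiplied by \<open>h(u) + h(v)\<close>. Since \<open>X^k\<close>
  divides \<open>h\<close>, the second part is invisible for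
  \<open>\<alpha>, \<beta> < k\<close>.\<close>

lemma partial_fraction_diag_coeff:
  fixes F p L :: "complex fps" and a b :: "'s \<Rightarrow> complex fps" and w :: "'s \<Rightarrow> complex" and \<epsilon> :: complex
  assumes F0: "fps_nth F 0 \<noteq> 0"
    and split: "\<And>s. s \<in> I \<Longrightarrow> fps_const (a s) - fps_lift (a s)
      = fps_const (fps_const \<epsilon>) * (fps_X - fps_const fps_X) * fps_const (b s) * fps_lift (b s)"
    and a: "(\<Sum>s\<in>I. fps_const (w s) * a s) = fps_X ^ k * p * inverse F ^ 2 - L"
    and L: "fps_lift L = fps_const L"
    and \<alpha>: "\<alpha> < k" and \<beta>: "\<beta> < k"
  shows "\<epsilon> * (\<Sum>s\<in>I. w s * fps_nth (F * b s) \<alpha> * fps_nth (F * b s) \<beta>) = - fps_nth (fps_X ^ k * p) (\<alpha> + \<beta> + 1)"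
proof -
  define M where "M = (\<Sum>s\<in>I. fps_const (fps_const (w s)) * (fps_const (F * b s) * fps_lift (F * b s)))"
  define W :: "complex fps fps" where "W = fps_X - fps_const fps_X"
  define f where "f = fps_X ^ k * p"
  define h where "h = f * inverse F"
  have hF: "h * F = f" using inverse_mult_eq_1[OF F0] by (simp add: h_def mult.assoc)
  have h: "h = fps_X ^ k * (p * inverse F)" by (simp add: h_def f_def mult.assoc)
  have "fps_const (fps_const \<epsilon>) * W * M = fps_const h * fps_lift F - fps_const F * fps_lift h"
    unfolding M_def W_def h_def f_def by (rule partial_fraction_sum[OF F0 F0 split a a L])
  \<comment> \<open>Adding and subtracting \<open>h(u) F(u)\<close> and \<open>h(v) F(v)\<close>
    turns the right side into differences of one series at \<open>u\<close> and \<open>v\<close>,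
    each divisible by \<open>v - u\<close>.\<close>
  also have "\<dots> = (fps_const (h * F) - fps_lift (h * F))
      + (fps_const h + fps_lift h) * (fps_lift F - fps_const F)"
    by (simp add: fps_lift_mult algebra_simps del: fps_const_mult flip: fps_const_mult)
  also have "\<dots> = W * ((fps_const h + fps_lift h) * fps_divided_difference F - fps_divided_difference f)"
  proof -
    have "fps_lift F - fps_const F = W * fps_divided_difference F"
      and "fps_const f - fps_lift f = - (W * fps_divided_difference f)"
      using fps_divided_difference[of F] fps_divided_difference[of f] by (simp_all add: W_def)
    then show ?thesis unfolding hF by (simp only:) (simp add: algebra_simps)
  qed
  finally have "W * (fps_const (fps_const \<epsilon>) * M)
      = W * ((fps_const h + fps_lift h) * fps_divided_difference F - fps_divided_difference f)"
    by (simp only: mult_ac)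
  moreover have "W \<noteq> 0"
  proof
    assume "W = 0"
    then have "fps_nth W 1 = 0" by simp
    then show False by (simp add: W_def)
  qed
  ultimately have M: "fps_const (fps_const \<epsilon>) * M
      = (fps_const h + fps_lift h) * fps_divided_difference F - fps_divided_difference f"
    by simp
  have "fps_lift h = fps_X ^ k * fps_lift (p * inverse F)"
    by (simp only: h fps_lift_mult fps_lift_power fps_lift_X)
  then have "fps_nth (fps_nth (fps_lift h * Z) \<beta>) \<alpha> = 0" for Z
    using coeff_X_power_lt[OF \<beta>] by (simp add: mult.assoc)
  moreover have "fps_nth (fps_nth (fps_const h * Z) \<beta>) \<alpha> = 0" for Z
    using \<alpha> by (simp add: h mult.assoc fps_X_power_mult_nth)
  ultimately have "fps_nth (fps_nth (fps_const (fps_const \<epsilon>) * M) \<beta>) \<alpha> = - fps_nth f (\<alpha> + \<beta> + 1)"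
    unfolding M by (simp add: distrib_right coeff_fps_divided_difference)
  then show ?thesis unfolding M_def f_def by (simp add: coeff_weighted_sum del: fps_mult_left_const_nth) (simp add: coeff_weighted_sum)
qed

section \<open>Flatness from a constant Gram matrix\<close>

lemma differentiable_has_partial:
  assumes "f differentiable (at x)"
  shows "\<exists>f'. (f has_derivative f') (at x) \<and> (\<forall>s. f' (axis s 1) = partial s f x)"
proof -
  obtain f' where f': "(f has_derivative f') (at x)"
    using assms by (auto simp: differentiable_def)
  with partial_eq[OF f'] show ?thesis by auto
qed

lemma partial_bilinear:
  assumes "finite I" "finite K" "\<And>p. p \<in> I \<Longrightarrow> f p differentiable (at x)" "\<And>q. q \<in> K \<Longrightarrow> g q differentiable (at x)"
  shows "partial s (\<lambda>y. \<Sum>p\<in>I. \<Sum>q\<in>K. w p q * f p y * g q y) x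
    = (\<Sum>p\<in>I. \<Sum>q\<in>K. w p q * (partial s (f p) x * g q x + f p x * partial s (g q) x))"
proof -
  have "\<exists>f'. \<forall>p\<in>I. (f p has_derivative f' p) (at x) \<and> (\<forall>s. f' p (axis s 1) = partial s (f p) x)"
    using assms(3) differentiable_has_partial by (intro bchoice) blast
  then obtain f' where f': "\<And>p. p \<in> I \<Longrightarrow> (f p has_derivative f' p) (at x)"
     "\<And>p s. p \<in> I \<Longrightarrow> f' p (axis s 1) = partial s (f p) x" by blast
  have "\<exists>g'. \<forall>p\<in>K. (g p has_derivative g' p) (at x) \<and> (\<forall>s. g' p (axis s 1) = partial s (g p) x)"
    using assms(4) differentiable_has_partial by (intro bchoice) blast
  then obtain g' where g': "\<And>p. p \<in> K \<Longrightarrow> (g p has_derivative g' p) (at x)"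
     "\<And>p s. p \<in> K \<Longrightarrow> g' p (axis s 1) = partial s (g p) x" by blast
  have "((\<lambda>y. \<Sum>p\<in>I. \<Sum>q\<in>K. w p q * (f p y * g q y)) has_derivative
     (\<lambda>h. \<Sum>p\<in>I. \<Sum>q\<in>K. w p q * (f p x * g' q h + f' p h * g q x))) (at x)"
    by (intro has_derivative_sum has_derivative_mult_right has_derivative_mult f' g')
  from partial_eq[OF this, of s] show ?thesis
    using f'(2) g'(2) by (simp add: mult.assoc add.commute)
qed

text \<open>The covariant metric is \<open>J\<^sup>T \<eta> J\<close> with \<open>J\<close> the Jacobian of \<open>Y\<close> and \<open>\<eta> = G\<^sup>-\<^sup>1\<close> constant, so the
  Christoffel symbols reduce to second derivatives of \<open>Y\<close>.\<close>

lemma hess_zero_if_gram_const: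
  fixes Y :: "'i \<Rightarrow> complex^'n \<Rightarrow> complex" and x :: "complex^'n"
  assumes card: "card I = CARD('n)" and U: "open U" "x \<in> U"
    and P_nz: "\<And>y a. y \<in> U \<Longrightarrow> P (y $ a) \<noteq> 0"
    and distinct: "\<And>y a b. y \<in> U \<Longrightarrow> a \<noteq> b \<Longrightarrow> y $ a \<noteq> y $ b"
    and gram: "\<And>y A B. y \<in> U \<Longrightarrow> A \<in> I \<Longrightarrow> B \<in> I \<Longrightarrow> gstar P y (Y A) (Y B) = G A B"
    and nondeg: "nondegenerate_on I G"
    and diff: "\<And>A b. A \<in> I \<Longrightarrow> partial b (Y A) differentiable (at x)"
    and comm: "\<And>A a b. A \<in> I \<Longrightarrow> partial a (partial b (Y A)) x = partial b (partial a (Y A)) x"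
    and A: "A \<in> I"
  shows "hess P (Y A) x a b = 0"
proof -
  have finI: "finite I" using card by (metis card.infinite zero_less_card_finite less_irrefl)
  then obtain \<phi> :: "'n \<Rightarrow> 'i" where \<phi>: "bij_betw \<phi> UNIV I"
    using card finite_same_card_bij[of "UNIV :: 'n set" I] by auto
  then have \<phi>I: "\<phi> p \<in> I" for p using bij_betwE by blast
  define J where "J y = (\<chi> p a. partial a (Y (\<phi> p)) y)" for y
  define H where "H y = (\<chi> a b. ginv P y a b)" for y :: "complex^'n"
  define C where "C y = (\<chi> a b. gcov P y a b)" for y :: "complex^'n"
  define M where "M = (\<chi> p q. G (\<phi> p) (\<phi> q))"
  have JHJ: "J y ** H y ** transpose (J y) = M" if "y \<in> U" for y
  proof -
    have "(J y ** H y ** transpose (J y)) $ p $ q = M $ p $ q" for p q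
    proof -
      have "(J y ** H y ** transpose (J y)) $ p $ q
         = (\<Sum>b\<in>UNIV. \<Sum>a\<in>UNIV. ginv P y a b * partial a (Y (\<phi> p)) y * partial b (Y (\<phi> q)) y)"
        by (simp add: matrix_matrix_mult_def transpose_def J_def H_def sum_distrib_left sum_distrib_right mult_ac)
      also have "\<dots> = gstar P y (Y (\<phi> p)) (Y (\<phi> q))"
        unfolding gstar_def by (rule sum.swap)
      finally show ?thesis using gram[OF that \<phi>I \<phi>I] by (simp add: M_def)
    qed
    then show ?thesis by (simp add: vec_eq_iff)
  qed
  have HC: "H y ** C y = mat 1" if "y \<in> U" for y
  proof -
    have "(H y ** C y) $ i $ j = mat 1 $ i $ j" for i j
    proof -
      have nz: "(\<Prod>j\<in>UNIV - {i}. (y $ i - y $ j)) \<noteq> 0"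
        using distinct[OF that] by (auto simp: prod_zero_iff)
      have "(H y ** C y) $ i $ j = (\<Sum>k\<in>UNIV. if k = i then ginv P y i i * gcov P y i j else 0)"
        unfolding matrix_matrix_mult_def H_def C_def vec_lambda_beta by (rule sum.cong) (auto simp: ginv_def)
      also have "\<dots> = ginv P y i i * gcov P y i j" by simp
      finally show ?thesis using nz P_nz[OF that, of i]
        by (cases "i = j") (auto simp: ginv_def gcov_def mat_def simp del: prod_zero_iff)
    qed
    then show ?thesis by (simp add: vec_eq_iff)
  qed
  \<comment> \<open>\<open>nondegenerate_on\<close> sums over the first index, so it speaks of the
    kernel of the transpose.\<close>
  have "transpose M *v v = 0 \<Longrightarrow> v = 0" for v
  proof -
    assume v: "transpose M *v v = 0"
    define w where "w = (\<lambda>A. v $ inv_into UNIV \<phi> A)"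
    have w: "w (\<phi> p) = v $ p" for p
      using \<phi> by (simp add: w_def bij_betw_def)
    have "(\<Sum>A\<in>I. w A * G A B) = 0" if B: "B \<in> I" for B
    proof -
      obtain q where q: "B = \<phi> q" using \<phi> B by (auto simp: bij_betw_def)
      have "(\<Sum>A\<in>I. w A * G A B) = (\<Sum>p\<in>UNIV. w (\<phi> p) * G (\<phi> p) B)"
        by (rule sum.reindex_bij_betw[OF \<phi>, symmetric])
      also have "\<dots> = (transpose M *v v) $ q"
        by (simp add: w q matrix_vector_mult_def transpose_def M_def mult.commute)
      finally show ?thesis using v by simp
    qed
    then have "\<forall>A\<in>I. w A = 0" using nondeg unfolding nondegenerate_on_def by blast
    then have "v $ p = 0" for p using \<phi>I[of p] w[of p] by auto
    then show "v = 0" by (simp add: vec_eq_iff)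
  qed
  then obtain N where "N ** transpose M = mat 1"
    using matrix_left_invertible_ker[of "transpose M"] by blast
  then have "M ** transpose N = mat 1"
    by (metis matrix_transpose_mul transpose_mat transpose_transpose)
  then obtain \<eta> where M\<eta>: "M ** \<eta> = mat 1" by blast
  then have \<eta>M: "\<eta> ** M = mat 1" by (simp add: matrix_left_right_inverse)
  have Hs: "transpose (H x) = H x"
    by (auto simp: H_def ginv_def transpose_def vec_eq_iff)
  have Mt: "transpose M = M"
    using JHJ[OF U(2)] Hs by (metis matrix_transpose_mul transpose_transpose matrix_mul_assoc)
  then have "transpose \<eta> ** M = mat 1"
    using M\<eta> by (metis matrix_transpose_mul transpose_mat)
  then have \<eta>T: "transpose \<eta> = \<eta>"
    using M\<eta> \<eta>M by (metis matrix_mul_assoc matrix_mul_lid matrix_mul_rid)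
  then have \<eta>s: "\<eta> $ p $ q = \<eta> $ q $ p" for p q
    by (metis transpose_def vec_lambda_beta)
  have gcov: "gcov P y a b = (\<Sum>p\<in>UNIV. \<Sum>q\<in>UNIV. \<eta> $ p $ q * partial a (Y (\<phi> p)) y * partial b (Y (\<phi> q)) y)"
    if y: "y \<in> U" for y a b
  proof -
    \<comment> \<open>A one-sided inverse of a square matrix is two-sided, so \<open>J\<close> may
      be moved from the left end to the right. This exhibits \<open>J^T \<eta> J\<close> as the
      inverse of the contravariant metric without inverting \<open>J\<close> separately.\<close>
    have "J y ** (H y ** transpose (J y) ** \<eta>) = mat 1"
      using JHJ[OF y] M\<eta> by (metis matrix_mul_assoc)
    then have "(H y ** transpose (J y) ** \<eta>) ** J y = mat 1"
      by (simp add: matrix_left_right_inverse)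
    then have 1: "H y ** (transpose (J y) ** \<eta> ** J y) = mat 1"
      by (metis matrix_mul_assoc)
    have "C y ** H y = mat 1" using HC[OF y] by (simp add: matrix_left_right_inverse)
    then have "transpose (J y) ** \<eta> ** J y = C y"
      using 1 by (metis matrix_mul_assoc matrix_mul_lid matrix_mul_rid)
    then have "gcov P y a b = (transpose (J y) ** \<eta> ** J y) $ a $ b"
      by (simp add: C_def)
    also have "\<dots> = (\<Sum>q\<in>UNIV. \<Sum>p\<in>UNIV. \<eta> $ p $ q * partial a (Y (\<phi> p)) y * partial b (Y (\<phi> q)) y)"
      by (simp add: matrix_matrix_mult_def transpose_def J_def sum_distrib_left sum_distrib_right mult_ac)
    finally show ?thesis by (subst sum.swap)
  qed
  have dJ: "partial b (Y (\<phi> p)) differentiable (at x)" for b p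
    by (rule diff[OF \<phi>I])
  define K where "K p a b = partial a (partial b (Y (\<phi> p))) x" for p a b
  define j where "j p a = partial a (Y (\<phi> p)) x" for p a
  have K: "K p a b = K p b a" for p a b
    unfolding K_def by (rule comm[OF \<phi>I])
  define S where "S u v = (\<Sum>p\<in>UNIV. \<Sum>q\<in>UNIV. \<eta> $ p $ q * (u p * v q))" for u v
  have S_sym: "S u v = S v u" for u v
    unfolding S_def by (subst sum.swap) (simp add: \<eta>s mult.commute[of "u _"])
  have dg: "partial c (\<lambda>y. gcov P y a b) x = S (\<lambda>p. K p c a) (\<lambda>q. j q b) + S (\<lambda>p. j p a) (\<lambda>q. K q c b)" for a b c
  proof -
    have "partial c (\<lambda>y. gcov P y a b) x = partial c (\<lambda>y. \<Sum>p\<in>UNIV. \<Sum>q\<in>UNIV.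
        \<eta> $ p $ q * partial a (Y (\<phi> p)) y * partial b (Y (\<phi> q)) y) x"
      by (rule partial_cong_open[OF U gcov])
        (auto intro!: differentiable_sum differentiable_mult differentiable_const dJ)
    also have "\<dots> = (\<Sum>p\<in>UNIV. \<Sum>q\<in>UNIV. \<eta> $ p $ q * (K p c a * j q b + j p a * K q c b))"
      unfolding K_def j_def by (rule partial_bilinear) (simp_all add: dJ)
    finally show ?thesis by (simp add: S_def distrib_left sum.distrib)
  qed
  \<comment> \<open>Christoffel symbols of the first kind. As \<open>\<eta>\<close> is constant and
    symmetric and mixed partials agree, four of the six terms cancel in pairs and the other two
    coincide.\<close>
  have lower: "partial a (\<lambda>y. gcov P y b e) x + partial b (\<lambda>y. gcov P y a e) x - partial e (\<lambda>y. gcov P y a b) x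
      = 2 * S (\<lambda>p. K p a b) (\<lambda>q. j q e)" for e
  proof -
    have "S (\<lambda>p. j p b) (\<lambda>q. K q a e) = S (\<lambda>p. K p e a) (\<lambda>q. j q b)"
      by (subst S_sym) (simp only: K[of _ a e])
    moreover have "S (\<lambda>p. j p a) (\<lambda>q. K q b e) = S (\<lambda>p. j p a) (\<lambda>q. K q e b)"
      by (simp only: K[of _ b e])
    moreover have "S (\<lambda>p. K p b a) (\<lambda>q. j q e) = S (\<lambda>p. K p a b) (\<lambda>q. j q e)"
      by (simp only: K[of _ b a])
    ultimately show ?thesis unfolding dg by simp
  qed
  obtain r where r: "A = \<phi> r" using \<phi> A by (auto simp: bij_betw_def)
  have M: "(\<Sum>c\<in>UNIV. \<Sum>e\<in>UNIV. ginv P x c e * j q e * j r c) = M $ q $ r" for q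
  proof -
    have "M $ r $ q = (\<Sum>c\<in>UNIV. \<Sum>e\<in>UNIV. ginv P x c e * j q e * j r c)"
      using gram[OF U(2) \<phi>I[of r] \<phi>I[of q]] by (simp add: gstar_def M_def j_def mult_ac)
    moreover have "transpose M $ q $ r = M $ r $ q" by (simp add: transpose_def)
    ultimately show ?thesis unfolding Mt by simp
  qed
  \<comment> \<open>The sums over \<open>c\<close> and \<open>e\<close> assemble
    \<open>g^*(dY_q, dY_r) = M $ q $ r\<close>. Then \<open>\<eta> ** M = mat 1\<close> collapses
    the rest to the second derivative of \<open>Y_r\<close>, exactly the term from which it is
    subtracted in \<open>hess\<close>.\<close>
  have "(\<Sum>c\<in>UNIV. christoffel P x c a b * partial c (Y A) x)
     = (\<Sum>c\<in>UNIV. \<Sum>e\<in>UNIV. \<Sum>p\<in>UNIV. \<Sum>q\<in>UNIV. \<eta> $ p $ q * K p a b * (ginv P x c e * j q e * j r c))"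
    unfolding christoffel_def lower r j_def[symmetric] S_def
    by (simp add: sum_distrib_left sum_distrib_right mult_ac)
  also have "\<dots> = (\<Sum>c\<in>UNIV. \<Sum>p\<in>UNIV. \<Sum>e\<in>UNIV. \<Sum>q\<in>UNIV. \<eta> $ p $ q * K p a b * (ginv P x c e * j q e * j r c))"
    by (rule sum.cong[OF refl]) (rule sum.swap)
  also have "\<dots> = (\<Sum>p\<in>UNIV. \<Sum>c\<in>UNIV. \<Sum>e\<in>UNIV. \<Sum>q\<in>UNIV. \<eta> $ p $ q * K p a b * (ginv P x c e * j q e * j r c))"
    by (rule sum.swap)
  also have "\<dots> = (\<Sum>p\<in>UNIV. \<Sum>c\<in>UNIV. \<Sum>q\<in>UNIV. \<Sum>e\<in>UNIV. \<eta> $ p $ q * K p a b * (ginv P x c e * j q e * j r c))"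
    by (rule sum.cong[OF refl], rule sum.cong[OF refl]) (rule sum.swap)
  also have "\<dots> = (\<Sum>p\<in>UNIV. \<Sum>q\<in>UNIV. \<Sum>c\<in>UNIV. \<Sum>e\<in>UNIV. \<eta> $ p $ q * K p a b * (ginv P x c e * j q e * j r c))"
    by (rule sum.cong[OF refl]) (rule sum.swap)
  also have "\<dots> = (\<Sum>p\<in>UNIV. \<Sum>q\<in>UNIV. \<eta> $ p $ q * K p a b * M $ q $ r)"
    by (simp add: M flip: sum_distrib_left)
  also have "\<dots> = (\<Sum>p\<in>UNIV. K p a b * (\<eta> ** M) $ p $ r)"
    by (simp add: matrix_matrix_mult_def sum_distrib_left mult_ac)
  also have "\<dots> = (\<Sum>p\<in>UNIV. if p = r then K p a b else 0)"
    unfolding \<eta>M by (intro sum.cong) (auto simp: mat_def)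
  also have "\<dots> = K r a b"
    by simp
  finally show ?thesis by (simp add: hess_def K_def r)
qed

section \<open>Nondegeneracy of the Gram matrix\<close>

text \<open>Entries with \<open>a + b < k - 1\<close> vanish and those with
  \<open>a + b = k - 1\<close> equal \<open>h 0\<close>. Equation \<open>b = j\<close> thus involves
  only \<open>v (k - 1 - j)\<close> and entries of larger index, so the kernel vector is eliminated
  from the top index downwards.\<close>

lemma antitriangular_kernel_zero:
  fixes h :: "int \<Rightarrow> complex" and v :: "nat \<Rightarrow> complex"
  assumes neg: "\<And>j. j < 0 \<Longrightarrow> h j = 0" and h0: "h 0 \<noteq> 0"
    and ker: "\<And>b. b < k \<Longrightarrow> (\<Sum>a<k. v a * h (int a + int b - int k + 1)) = 0"
    and "a < k"
  shows "v a = 0"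
proof -
  have "v (k - 1 - j) = 0" if "j < k" for j
    using that
  proof (induction j rule: less_induct)
    case (less j)
    have "v a * h (int a + int j - int k + 1) = (if a = k - 1 - j then v a * h 0 else 0)" if "a < k" for a
    proof (cases a "k - 1 - j" rule: linorder_cases)
      case greater
      then have "v (k - 1 - (k - 1 - a)) = 0"
        using that less.prems by (intro less.IH) auto
      then show ?thesis using that greater by simp
    next
      case less
      then show ?thesis using that by (simp add: neg)
    next
      case equal
      then have "int a + int j - int k + 1 = 0" using \<open>j < k\<close> by simp
      then show ?thesis using equal by simp
    qed
    then have "(\<Sum>a<k. v a * h (int a + int j - int k + 1)) = (\<Sum>a<k. if a = k - 1 - j then v a * h 0 else 0)"
      by (intro sum.cong) auto
    also have "\<dots> = v (k - 1 - j) * h 0" using less.prems by simp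
    finally show ?case using ker[OF less.prems] h0 by simp
  qed
  from this[of "k - 1 - a"] show ?thesis using \<open>a < k\<close> by simp
qed

lemma fidx_set_eq:
  "fidx_set k m d = (\<lambda>(i, a). Fin i a) ` (SIGMA i:{..<m}. {..<k i}) \<union> Inf ` {1..d}"
  unfolding fidx_set_def by auto

lemma finite_fidx_set: "finite (fidx_set k m d)"
  by (simp add: fidx_set_eq)

lemma card_fidx_set: "card (fidx_set k m d) = (\<Sum>i<m. k i) + d"
proof -
  have "card ((\<lambda>(i, a). Fin i a) ` (SIGMA i:{..<m}. {..<k i})) = (\<Sum>i<m. k i)"
    by (subst card_image) (auto simp: inj_on_def)
  moreover have "card (Inf ` {1..d}) = d"
    by (subst card_image) (auto simp: inj_on_def)
  ultimately show ?thesis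
    unfolding fidx_set_eq by (subst card_Un_disjoint) auto
qed

lemma Ptil_neg: "j < 0 \<Longrightarrow> Ptil mu k m i j = 0"
  by (simp add: Ptil_def tcoef_def)

lemma Rco_neg: "j < 0 \<Longrightarrow> Rco mu k m j = 0"
  by (simp add: Rco_def tcoef_def)

lemma nondegenerate_Gram:
  assumes c: "c \<noteq> 0" and mu: "\<forall>i<m. \<forall>j<m. i \<noteq> j \<longrightarrow> mu i \<noteq> mu j"
  shows "nondegenerate_on (fidx_set k m d) (Gram c mu k m d)"
  unfolding nondegenerate_on_def
proof (intro allI impI ballI)
  fix v A
  assume ker: "\<forall>B\<in>fidx_set k m d. (\<Sum>A\<in>fidx_set k m d. v A * Gram c mu k m d A B) = 0"
    and A: "A \<in> fidx_set k m d"
  let ?I = "fidx_set k m d"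
  show "v A = 0"
  proof (cases A)
    case (Fin i a)
    with A have i: "i < m" and a: "a < k i" by (auto simp: fidx_set_def)
    \<comment> \<open>The antidiagonal entry is the product of the
      \<open>(mu i - mu s) ^ k s\<close> over \<open>s \<noteq> i\<close>; this is where
      distinctness of the roots enters.\<close>
    have P0: "Ptil mu k m i 0 \<noteq> 0"
      using mu i by (auto simp: Ptil_def tcoef_def)
    have "(\<Sum>a<k i. v (Fin i a) * Ptil mu k m i (int a + int b - int (k i) + 1)) = 0" if b: "b < k i" for b
    proof -
      have "0 = (\<Sum>A\<in>?I. v A * Gram c mu k m d A (Fin i b))"
        using ker i b by (auto simp: fidx_set_def)
      also have "\<dots> = (\<Sum>A\<in>Fin i ` {..<k i}. v A * Gram c mu k m d A (Fin i b))"
      proof (rule sum.mono_neutral_right[OF finite_fidx_set])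
        show "\<forall>A\<in>?I - Fin i ` {..<k i}. v A * Gram c mu k m d A (Fin i b) = 0"
        proof
          fix A assume *: "A \<in> ?I - Fin i ` {..<k i}"
          show "v A * Gram c mu k m d A (Fin i b) = 0"
          proof (cases A)
            case (Fin i' a')
            with * have "i' \<noteq> i" by (auto simp: fidx_set_def)
            then show ?thesis using Fin by simp
          qed simp
        qed
      qed (use i in \<open>auto simp: fidx_set_def\<close>)
      also have "\<dots> = (\<Sum>a<k i. v (Fin i a) * Gram c mu k m d (Fin i a) (Fin i b))"
        by (subst sum.reindex) (auto simp: inj_on_def)
      also have "\<dots> = c * (\<Sum>a<k i. v (Fin i a) * Ptil mu k m i (int a + int b - int (k i) + 1))"
        by (simp add: sum_distrib_left mult_ac)
      finally show ?thesis using c by simp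
    qed
    from antitriangular_kernel_zero[OF Ptil_neg P0 this a] show ?thesis using Fin by simp
  next
    case (Inf a)
    with A have a: "a - 1 < d" "1 \<le> a" by (auto simp: fidx_set_def)
    have R0: "Rco mu k m 0 \<noteq> 0"
      by (simp add: Rco_def tcoef_def)
    \<comment> \<open>Labels at infinity start at 1. Shifting both indices by one turns the offset
      \<open>- d - 1\<close> into \<open>- d + 1\<close>, the shape treated by the antitriangular
      elimination.\<close>
    have "(\<Sum>a<d. v (Inf (Suc a)) * Rco mu k m (int a + int b - int d + 1)) = 0" if b: "b < d" for b
    proof -
      have "0 = (\<Sum>A\<in>?I. v A * Gram c mu k m d A (Inf (Suc b)))"
        using ker b by (auto simp: fidx_set_def)
      also have "\<dots> = (\<Sum>A\<in>(\<lambda>a. Inf (Suc a)) ` {..<d}. v A * Gram c mu k m d A (Inf (Suc b)))"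
      proof (rule sum.mono_neutral_right[OF finite_fidx_set])
        show "\<forall>A\<in>?I - (\<lambda>a. Inf (Suc a)) ` {..<d}. v A * Gram c mu k m d A (Inf (Suc b)) = 0"
        proof
          fix A assume *: "A \<in> ?I - (\<lambda>a. Inf (Suc a)) ` {..<d}"
          show "v A * Gram c mu k m d A (Inf (Suc b)) = 0"
          proof (cases A)
            case (Inf a')
            with * have "1 \<le> a'" "a' \<le> d" by (auto simp: fidx_set_def)
            then have "A = Inf (Suc (a' - 1))" "a' - 1 < d" using Inf by auto
            with * show ?thesis by blast
          qed simp
        qed
      qed (auto simp: fidx_set_def)
      also have "\<dots> = (\<Sum>a<d. v (Inf (Suc a)) * Gram c mu k m d (Inf (Suc a)) (Inf (Suc b)))"
        by (subst sum.reindex) (auto simp: inj_on_def)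
      also have "\<dots> = - c * (\<Sum>a<d. v (Inf (Suc a)) * Rco mu k m (int a + int b - int d + 1))"
      proof -
        have "int (Suc a) + int (Suc b) - int d - 1 = int a + int b - int d + 1" for a by simp
        then show ?thesis by (simp only: Gram.simps) (simp add: sum_distrib_left mult_ac sum_negf)
      qed
      finally show ?thesis using c by simp
    qed
    from antitriangular_kernel_zero[where v = "\<lambda>a. v (Inf (Suc a))", OF Rco_neg R0 this a(1)]
    show ?thesis using Inf a(2) by simp
  qed
qed

section \<open>Lagrange interpolation and Taylor expansions\<close>

text \<open>The \<open>n\<close> nodes determine a polynomial only below degree \<open>n\<close>.
  The missing coefficient is matched by a multiple of the monic product, which vanishes at every
  node.\<close>

lemma lagrange_interpolation_lead:
  fixes x :: "complex^'n" and p :: "complex poly"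
  assumes deg: "degree p \<le> CARD('n)" and inj: "inj (($) x)"
  shows "p = smult (coeff p CARD('n)) (\<Prod>s\<in>UNIV. [:- (x $ s), 1:])
    + (\<Sum>s\<in>UNIV. smult (poly p (x $ s) / (\<Prod>j\<in>UNIV - {s}. (x $ s - x $ j)))
         (\<Prod>j\<in>UNIV - {s}. [:- (x $ j), 1:]))"
    (is "_ = smult ?l ?D + (\<Sum>s\<in>UNIV. smult (?w s) (?D' s))")
proof (rule poly_eqI_degree_lead_coeff[where n = "CARD('n)" and A = "range (($) x)"])
  show "CARD('n) \<le> card (range (($) x))" using inj by (simp add: card_image)
  have dD: "degree ?D = CARD('n)"
    by (subst degree_prod_eq_sum_degree) auto
  have dD': "degree (?D' s) = CARD('n) - 1" for s
    by (subst degree_prod_eq_sum_degree) auto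
  have "coeff ?D CARD('n) = 1"
    using lead_coeff_prod[of "\<lambda>s. [:- (x $ s), 1:]" UNIV] unfolding dD by simp
  moreover have "coeff (?D' s) CARD('n) = 0" for s
    by (rule coeff_eq_0) (simp add: dD' zero_less_card_finite)
  ultimately show "coeff p CARD('n) = coeff (smult ?l ?D + (\<Sum>s\<in>UNIV. smult (?w s) (?D' s))) CARD('n)"
    by (simp add: coeff_sum)
  show "degree p \<le> CARD('n)" by (rule deg)
  show "degree (smult ?l ?D + (\<Sum>s\<in>UNIV. smult (?w s) (?D' s))) \<le> CARD('n)"
  proof (intro degree_add_le degree_sum_le)
    show "degree (smult ?l ?D) \<le> CARD('n)" using degree_smult_le[of ?l ?D] dD by simp
    show "degree (smult (?w s) (?D' s)) \<le> CARD('n)" for s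
      using degree_smult_le[of "?w s" "?D' s"] dD'[of s] by simp
  qed simp
  fix z assume "z \<in> range (($) x)"
  then obtain t where z: "z = x $ t" by blast
  have "poly ?D z = 0" by (auto simp: poly_prod z)
  moreover have "?w s * poly (?D' s) z = (if s = t then poly p z else 0)" for s
  proof (cases "s = t")
    case True
    have "(\<Prod>j\<in>UNIV - {t}. (x $ t - x $ j)) \<noteq> 0" using inj by (auto simp: inj_eq)
    then show ?thesis using True by (simp add: poly_prod z)
  next
    case False
    then have "poly (?D' s) z = 0" by (auto simp: poly_prod z)
    then show ?thesis using False by simp
  qed
  ultimately show "poly p z = poly (smult ?l ?D + (\<Sum>s\<in>UNIV. smult (?w s) (?D' s))) z"
    by (simp add: poly_sum)
qed

text \<open>Interpolation rewritten in the local parameter \<open>t - z\<close>. The factors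
  \<open>-1\<close> and \<open>1\<close> are kept so that the result has the form
  \<open>A + x_s B\<close> of the branch locale and parallels the case of infinity.\<close>

lemma lagrange_interpolation_shift:
  fixes x :: "complex^'n" and p :: "complex poly"
  assumes "degree p \<le> CARD('n)" "inj (($) x)"
  shows "fps_of_poly (pcompose p [:z, 1:])
    = fps_const (coeff p CARD('n)) * (\<Prod>s\<in>UNIV. (fps_X + fps_const z) + fps_const (x $ s) * (-1))
    + (\<Sum>s\<in>UNIV. fps_const (poly p (x $ s) / (\<Prod>j\<in>UNIV - {s}. (x $ s - x $ j))) *
        (1 * (\<Prod>j\<in>UNIV - {s}. (fps_X + fps_const z) + fps_const (x $ j) * (-1))))"
proof -
  have q: "fps_of_poly (pcompose [:- y, 1:] [:z, 1:]) = (fps_X + fps_const z) + fps_const y * (-1)" for y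
  proof -
    have "pcompose [:- y, 1:] [:z, 1:] = [:z - y, 1:]" by (simp add: pcompose_pCons)
    then show ?thesis by (simp add: fps_of_poly_linear)
  qed
  from arg_cong[OF lagrange_interpolation_lead[OF assms], of "\<lambda>p. fps_of_poly (pcompose p [:z, 1:])"]
  show ?thesis
    by (simp only: pcompose_add pcompose_smult pcompose_sum pcompose_prod fps_of_poly_add fps_of_poly_smult
        fps_of_poly_sum fps_of_poly_prod q mult_1)
qed

text \<open>The same in the parameter \<open>1 / t\<close>, after multiplication by the
  \<open>n\<close>-th power. The cofactors have degree \<open>n - 1\<close> only, so one power of
  the parameter is left over: the extra \<open>fps_X\<close>.\<close>

lemma lagrange_interpolation_reflect:
  fixes x :: "complex^'n" and p :: "complex poly"
  assumes deg: "degree p \<le> CARD('n)" and inj: "inj (($) x)"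
    and r: "\<And>t. t \<noteq> 0 \<Longrightarrow> poly r t = t ^ CARD('n) * poly p (1 / t)"
  shows "fps_of_poly r
    = fps_const (coeff p CARD('n)) * (\<Prod>s\<in>UNIV. 1 + fps_const (x $ s) * (- fps_X))
    + (\<Sum>s\<in>UNIV. fps_const (poly p (x $ s) / (\<Prod>j\<in>UNIV - {s}. (x $ s - x $ j))) *
        (fps_X * (\<Prod>j\<in>UNIV - {s}. 1 + fps_const (x $ j) * (- fps_X))))"
proof -
  define w where "w s = poly p (x $ s) / (\<Prod>j\<in>UNIV - {s}. (x $ s - x $ j))" for s
  define l where "l = coeff p CARD('n)"
  define r' where "r' = smult l (\<Prod>s\<in>UNIV. [:1, - (x $ s):])
     + (\<Sum>s\<in>UNIV. smult (w s) ([:0, 1:] * (\<Prod>j\<in>UNIV - {s}. [:1, - (x $ j):])))"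
  have "poly r' t = poly r t" if t: "t \<noteq> 0" for t
  proof -
    have p: "poly p (1 / t) = l * (\<Prod>s\<in>UNIV. (1 / t - x $ s)) + (\<Sum>s\<in>UNIV. w s * (\<Prod>j\<in>UNIV - {s}. (1 / t - x $ j)))"
      using arg_cong[OF lagrange_interpolation_lead[OF deg inj], of "\<lambda>p. poly p (1 / t)"]
      by (simp add: poly_sum poly_prod w_def l_def)
    have scale: "t ^ card J * (\<Prod>j\<in>J. (1 / t - x $ j)) = (\<Prod>j\<in>J. (1 - t * x $ j))" for J :: "'n set"
      using t by (simp add: prod_constant[symmetric] right_diff_distrib del: prod_constant flip: prod.distrib)
    have card: "t ^ CARD('n) = t * t ^ card (UNIV - {s})" for s :: 'n
      by (simp add: card_Diff_singleton power_Suc[symmetric] zero_less_card_finite del: power_Suc)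
    have scale': "t ^ CARD('n) * (\<Prod>j\<in>UNIV - {s}. (1 / t - x $ j)) = t * (\<Prod>j\<in>UNIV - {s}. (1 - t * x $ j))"
      for s by (simp only: card[of s] mult.assoc scale)
    have "poly r t = l * (t ^ CARD('n) * (\<Prod>s\<in>UNIV. (1 / t - x $ s)))
       + (\<Sum>s\<in>UNIV. w s * (t ^ CARD('n) * (\<Prod>j\<in>UNIV - {s}. (1 / t - x $ j))))"
      unfolding r[OF t] p by (simp add: distrib_left sum_distrib_left mult_ac)
    also have "\<dots> = l * (\<Prod>s\<in>UNIV. (1 - t * x $ s)) + (\<Sum>s\<in>UNIV. w s * (t * (\<Prod>j\<in>UNIV - {s}. (1 - t * x $ j))))"
      unfolding scale scale' ..
    also have "\<dots> = poly r' t"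
      by (simp add: r'_def poly_sum poly_prod sum_distrib_left mult.left_commute)
    finally show ?thesis ..
  qed
  \<comment> \<open>Equality is known away from 0 only. Multiplying by the variable makes it hold at
    every point, and the factor cancels again as polynomials.\<close>
  then have "poly ([:0, 1:] * r') t = poly ([:0, 1:] * r) t" for t
    by (cases "t = 0") simp_all
  then have "[:0, 1:] * r' = [:0, 1:] * r" by (simp only: poly_eq_poly_eq_iff[symmetric] fun_eq_iff simp_thms)
  then have "r = r'" by simp
  have q: "fps_of_poly [:1, - y:] = 1 + fps_const y * (- fps_X :: complex fps)" for y
    by (simp add: fps_of_poly_linear' flip: fps_const_neg)
  show ?thesis unfolding \<open>r = r'\<close> r'_def
    by (simp only: fps_of_poly_add fps_of_poly_smult fps_of_poly_mult
        fps_of_poly_sum fps_of_poly_prod q fps_of_poly_fps_X w_def l_def)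
qed

section \<open>From branches of the square root to formal series, and partial fractions\<close>

lemma tcoef_eq_fps_nth:
  assumes "(\<lambda>t. f (z + t)) has_fps_expansion F"
  shows "tcoef f z j = (if j < 0 then 0 else fps_nth F (nat j))"
  using fps_nth_fps_expansion[OF assms] higher_deriv_shift_0[of "nat j" f z]
  by (simp add: tcoef_def o_def)

lemma fps_expansion_power2:
  assumes "r > 0" "f holomorphic_on ball z r" "\<And>t. t \<in> ball z r \<Longrightarrow> f t ^ 2 = g t"
    and G: "(\<lambda>t. g (z + t)) has_fps_expansion G"
  shows "fps_expansion f z ^ 2 = G"
proof (rule fps_expansion_unique_complex[OF _ G])
  have "f analytic_on {z}"
    using assms(1,2) by (meson analytic_at centre_in_ball open_ball)
  then have F: "(\<lambda>t. f (z + t)) has_fps_expansion fps_expansion f z"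
    by (rule analytic_at_imp_has_fps_expansion)
  have "eventually (\<lambda>t. t \<in> ball 0 r) (nhds (0::complex))"
    using assms(1) by (intro eventually_nhds_in_open) auto
  then have ev: "eventually (\<lambda>t. f (z + t) ^ 2 = g (z + t)) (nhds 0)"
    by eventually_elim (auto intro!: assms(3) simp: dist_norm)
  show "(\<lambda>t. g (z + t)) has_fps_expansion fps_expansion f z ^ 2"
    using has_fps_expansion_power[OF F, of 2] has_fps_expansion_cong[OF ev refl] by blast
qed

lemma det_mat_minus_Lmat: "det (mat t - Lmat x) = (\<Prod>s\<in>UNIV. (t - x $ s))"
  by (subst det_diagonal) (simp_all add: mat_def Lmat_def)

lemma det_one_minus_mat_Lmat: "det (mat 1 - mat t ** Lmat x) = (\<Prod>s\<in>UNIV. (1 - t * x $ s))"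
proof -
  have "mat t ** Lmat x = (\<chi> i j. if i = j then t * x $ i else 0)"
    by (simp add: vec_eq_iff matrix_matrix_mult_def mat_def Lmat_def if_distrib[of "\<lambda>u. u * _"] sum.delta cong: if_cong)
  then show ?thesis by (subst det_diagonal) (simp_all add: mat_def)
qed

lemma gstar_diagonal:
  "gstar P x Y Z = (\<Sum>s\<in>UNIV. P (x $ s) / (\<Prod>j\<in>UNIV - {s}. (x $ s - x $ j)) * partial s Y x * partial s Z x)"
proof -
  have "(\<Sum>b\<in>UNIV. ginv P x a b * partial a Y x * partial b Z x)
      = (\<Sum>b\<in>UNIV. if b = a then ginv P x a a * partial a Y x * partial a Z x else 0)" for a
    by (intro sum.cong refl) (auto simp: ginv_def)
  then show ?thesis by (simp add: gstar_def ginv_def)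
qed

context fps_sqrt_branch
begin

text \<open>Dividing the interpolation formula by \<open>F x ^ 2\<close>, the full product, gives
  the partial fraction expansion. The numerator \<open>e\<close> is 1 at a finite point and
  \<open>fps_X\<close> at infinity.\<close>

lemma weighted_inverse_sum:
  assumes x: "x \<in> U" and f: "f = L * (\<Prod>s\<in>UNIV. q s x)
     + (\<Sum>s\<in>UNIV. fps_const (w s) * (e * (\<Prod>j\<in>UNIV - {s}. q j x)))"
  shows "(\<Sum>s\<in>UNIV. fps_const (w s) * (e * inverse (q s x))) = f * inverse (F x) ^ 2 - L"
proof -
  let ?S = "\<Sum>s\<in>UNIV. fps_const (w s) * (e * inverse (q s x))"
  have "f = F x ^ 2 * (L + ?S)"
    unfolding f prod_except_factor[OF x] square[OF x, symmetric] distrib_left sum_distrib_left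
    by (simp add: mult_ac)
  then have "f * inverse (F x) ^ 2 = (inverse (F x) * F x) ^ 2 * (L + ?S)"
    by (simp only: power_mult_distrib mult_ac)
  then show ?thesis using inverse_mult_eq_1[OF const_term_nz[OF x]] by simp
qed

end

text \<open>In each application the bracket on the right is free of \<open>x $ s\<close>, hence it
  can be pulled out of the sum over \<open>s\<close> as the common factor \<open>D\<close>.\<close>

lemma inverse_split:
  fixes q r e e' :: "complex fps"
  assumes "fps_nth q 0 \<noteq> 0" "fps_nth r 0 \<noteq> 0"
  shows "fps_const (e * inverse q) - fps_lift (e' * inverse r)
    = (fps_const e * fps_lift r - fps_lift e' * fps_const q) * fps_const (inverse q) * fps_lift (inverse r)"
proof -
  have "fps_const (inverse q) * fps_const q = 1" "fps_lift (inverse r) * fps_lift r = 1"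
    using assms by (simp_all add: inverse_mult_eq_1 fps_lift_1 flip: fps_lift_mult)
  moreover have "(fps_const e * fps_lift r - fps_lift e' * fps_const q) * fps_const (inverse q) * fps_lift (inverse r)
    = fps_const e * fps_const (inverse q) * (fps_lift (inverse r) * fps_lift r)
      - fps_lift e' * fps_lift (inverse r) * (fps_const (inverse q) * fps_const q)"
    by (simp add: algebra_simps del: fps_const_mult)
  ultimately show ?thesis by (simp add: fps_lift_mult)
qed

text \<open>Only the Taylor series at \<open>z\<close> matters, so the radius may vary with
  \<open>x\<close>. Each factor has constant term \<open>z - x $ s\<close>, nonzero because no
  coordinate equals \<open>z\<close>.\<close>

lemma fps_sqrt_branch_finite:
  fixes S :: "complex \<Rightarrow> complex^'n \<Rightarrow> complex"
  assumes U: "open U" and z: "\<And>x s. x \<in> U \<Longrightarrow> x $ s \<noteq> z"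
    and S: "\<forall>x\<in>U. \<exists>r>0. (\<lambda>t. S t x) holomorphic_on ball z r \<and>
        (\<forall>t\<in>ball z r. (S t x)^2 = det (mat t - Lmat x))"
    and cont: "continuous_on U (\<lambda>x. S z x)"
  shows "fps_sqrt_branch (fps_X + fps_const z) (-1) U (\<lambda>x. fps_expansion (\<lambda>t. S t x) z)"
proof
  show "open U" by (rule U)
  fix x assume x: "x \<in> U"
  then obtain r where r: "r > 0" "(\<lambda>t. S t x) holomorphic_on ball z r"
    "\<And>t. t \<in> ball z r \<Longrightarrow> (S t x)^2 = (\<Prod>s\<in>UNIV. (t - x $ s))"
    using S unfolding det_mat_minus_Lmat by blast
  have "(\<lambda>t. \<Prod>s\<in>UNIV. (z + t - x $ s)) has_fps_expansion (\<Prod>s\<in>UNIV. fps_const z + fps_X - fps_const (x $ s))"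
    by (intro fps_expansion_intros)
  also have "(\<Prod>s\<in>UNIV. fps_const z + fps_X - fps_const (x $ s)) = (\<Prod>s\<in>UNIV. fps_X + fps_const z + fps_const (x $ s) * (-1))"
    by (simp add: add.commute diff_conv_add_uminus del: add_uminus_conv_diff)
  finally show "fps_expansion (\<lambda>t. S t x) z ^ 2 = (\<Prod>s\<in>UNIV. fps_X + fps_const z + fps_const (x $ s) * (-1))"
    by (intro fps_expansion_power2[OF r])
  show "fps_nth (fps_X + fps_const z + fps_const (x $ s) * (-1)) 0 \<noteq> 0" for s
    using z[OF x, of s] by simp
next
  show "continuous_on U (\<lambda>y. fps_nth (fps_expansion (\<lambda>t. S t y) z) 0)"
    using cont by (simp add: fps_expansion_def)
qed

lemma fps_sqrt_branch_infinity:
  fixes S :: "complex \<Rightarrow> complex^'n \<Rightarrow> complex"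
  assumes U: "open U"
    and S: "\<forall>x\<in>U. \<exists>r>0. (\<lambda>t. S t x) holomorphic_on ball 0 r \<and>
        (\<forall>t\<in>ball 0 r. (S t x)^2 = det (mat 1 - mat t ** Lmat x))"
    and cont: "continuous_on U (\<lambda>x. S 0 x)"
  shows "fps_sqrt_branch 1 (- fps_X) U (\<lambda>x. fps_expansion (\<lambda>t. S t x) 0)"
proof
  show "open U" by (rule U)
  fix x assume x: "x \<in> U"
  then obtain r where r: "r > 0" "(\<lambda>t. S t x) holomorphic_on ball 0 r"
    "\<And>t. t \<in> ball 0 r \<Longrightarrow> (S t x)^2 = (\<Prod>s\<in>UNIV. (1 - t * x $ s))"
    using S unfolding det_one_minus_mat_Lmat by blast
  have "(\<lambda>t. \<Prod>s\<in>UNIV. (1 - t * x $ s)) has_fps_expansion (\<Prod>s\<in>UNIV. 1 - fps_X * fps_const (x $ s))"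
    by (intro fps_expansion_intros)
  then have *: "(\<lambda>t. \<Prod>s\<in>UNIV. (1 - (0 + t) * x $ s)) has_fps_expansion (\<Prod>s\<in>UNIV. 1 + fps_const (x $ s) * (- fps_X))"
    by (simp add: mult.commute)
  show "fps_expansion (\<lambda>t. S t x) 0 ^ 2 = (\<Prod>s\<in>UNIV. 1 + fps_const (x $ s) * (- fps_X))"
    by (rule fps_expansion_power2[OF r *])
  show "fps_nth (1 + fps_const (x $ s) * (- fps_X)) 0 \<noteq> 0" for s
    by simp
next
  show "continuous_on U (\<lambda>y. fps_nth (fps_expansion (\<lambda>t. S t y) 0) 0)"
    using cont by (simp add: fps_expansion_def)
qed

section \<open>Flat coordinates\<close>

lemma pcompose_power: "pcompose (p ^ n) r = pcompose p r ^ n"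
  for p r :: "'a::comm_semiring_1 poly"
  by (induction n) (simp_all add: pcompose_1 pcompose_mult)

locale flat_coordinates =
  fixes c :: complex and mu :: "nat \<Rightarrow> complex" and k :: "nat \<Rightarrow> nat" and m d :: nat
    and U :: "(complex^'n) set"
    and S :: "nat \<Rightarrow> complex \<Rightarrow> complex^'n \<Rightarrow> complex"
    and Sinf :: "complex \<Rightarrow> complex^'n \<Rightarrow> complex"
  assumes c_nz: "c \<noteq> 0"
    and mu_distinct: "\<forall>i<m. \<forall>j<m. i \<noteq> j \<longrightarrow> mu i \<noteq> mu j"
    and k_pos: "\<forall>i<m. 1 \<le> k i"
    and k_sum: "(\<Sum>i<m. k i) \<le> CARD('n)"
    and d_def: "d = CARD('n) - (\<Sum>i<m. k i)"
    and U_open: "open U"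
    and U_dom: "\<forall>x\<in>U. (\<forall>s t. s \<noteq> t \<longrightarrow> x $ s \<noteq> x $ t) \<and> (\<forall>s. \<forall>i<m. x $ s \<noteq> mu i)"
    and S_branch: "\<forall>i<m. \<forall>x\<in>U. \<exists>r>0. (\<lambda>t. S i t x) holomorphic_on ball (mu i) r \<and>
        (\<forall>t\<in>ball (mu i) r. (S i t x)^2 = det (mat t - Lmat x))"
    and S_cont: "\<forall>i<m. continuous_on U (\<lambda>x. S i (mu i) x)"
    and Sinf_branch: "\<forall>x\<in>U. \<exists>r>0. (\<lambda>t. Sinf t x) holomorphic_on ball 0 r \<and>
        (\<forall>t\<in>ball 0 r. (Sinf t x)^2 = det (mat 1 - mat t ** Lmat x))"
    and Sinf_cont: "continuous_on U (\<lambda>x. Sinf 0 x)"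
begin

abbreviation "P \<equiv> Ppoly c mu k m"
abbreviation "Y \<equiv> Yfun mu k m S Sinf"

definition "w x s = P (x $ s) / (\<Prod>j\<in>UNIV - {s}. (x $ s - x $ j))" for x :: "complex^'n"
definition "F i x = fps_expansion (\<lambda>t. S i t x) (mu i)"
definition "Finf x = fps_expansion (\<lambda>t. Sinf t x) 0"
definition "q i s x = fps_X + fps_const (mu i) + fps_const (x $ s) * (-1)" for x :: "complex^'n"
definition "qinf s x = 1 + fps_const (x $ s) * (- fps_X)" for x :: "complex^'n"
text \<open>\<open>Pt i\<close> is \<open>P\<^sub>i\<close>-tilde in the local parameter \<open>t - \<mu>\<^sub>i\<close>.\<close>

definition "Pt i = (\<Prod>s\<in>{..<m} - {i}. (fps_X + fps_const (mu i - mu s)) ^ k s)"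
definition "R = (\<Prod>i<m. (1 + fps_const (- mu i) * fps_X) ^ k i)"
definition "Pp = smult (-4 * c) (\<Prod>i<m. [:- mu i, 1:] ^ k i)"
text \<open>The polynomial part of \<open>P\<close> divided by the product of all
  \<open>t - x $ s\<close>: it equals \<open>-4 * c\<close> if \<open>d = 0\<close>, and 0
  otherwise.\<close>

definition "L = fps_const (coeff Pp CARD('n))"

lemma branch_F: "i < m \<Longrightarrow> fps_sqrt_branch (fps_X + fps_const (mu i)) (-1) U (F i)"
  unfolding F_def using U_open U_dom S_branch S_cont by (intro fps_sqrt_branch_finite) auto

lemma branch_Finf: "fps_sqrt_branch 1 (- fps_X) U Finf"
  unfolding Finf_def using U_open Sinf_branch Sinf_cont by (intro fps_sqrt_branch_infinity) auto

lemma Y_Fin: "Y (Fin i a) = (\<lambda>x. fps_nth (F i x) a - 0)"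
  by (rule ext) (simp add: F_def fps_expansion_def)

lemma Y_Inf: "Y (Inf a) = (\<lambda>x. fps_nth (Finf x) a - Rco mu k m (int a))"
  by (rule ext) (simp add: Finf_def fps_expansion_def)

lemma partial_Fin:
  assumes "i < m" "x \<in> U"
  shows "partial s (Y (Fin i a)) x = - (1/2) * fps_nth (F i x * inverse (q i s x)) a"
  unfolding Y_Fin fps_sqrt_branch.partial_coeff[OF branch_F[OF assms(1)] assms(2)] q_def[symmetric]
  by (simp add: mult.assoc)

text \<open>The coefficient \<open>B = - fps_X\<close> lowers the index by one. The labels
  \<open>1, ..., d\<close> thus become \<open>0, ..., d - 1\<close>, precisely the orders killed by
  \<open>fps_X ^ d\<close>.\<close>

lemma partial_Inf:
  assumes "1 \<le> a" "x \<in> U"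
  shows "partial s (Y (Inf a)) x = - (1/2) * fps_nth (Finf x * inverse (qinf s x)) (a - 1)"
proof -
  have *: "fps_const (1/2) * Finf x * (- fps_X) * inverse (qinf s x)
      = fps_const (- (1/2)) * (fps_X * (Finf x * inverse (qinf s x)))"
    by (simp add: mult_ac flip: fps_const_neg)
  show ?thesis
    unfolding Y_Inf fps_sqrt_branch.partial_coeff[OF branch_Finf assms(2)] qinf_def[symmetric] *
    using assms(1) by simp
qed

lemma poly_Pp: "poly Pp = P"
  by (rule ext) (simp add: Pp_def Ppoly_def poly_prod)

lemma degree_Pp: "degree Pp \<le> CARD('n)"
proof -
  have "degree Pp \<le> degree (\<Prod>i<m. [:- mu i, 1:] ^ k i)"
    unfolding Pp_def by (rule degree_smult_le)
  also have "\<dots> = (\<Sum>i<m. k i)"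
    by (subst degree_prod_eq_sum_degree) (auto simp: degree_linear_power)
  finally show ?thesis using k_sum by simp
qed

lemma inj_coords: "x \<in> U \<Longrightarrow> inj (($) x)"
  using U_dom by (meson injI)

lemma P_nz: "x \<in> U \<Longrightarrow> P (x $ s) \<noteq> 0"
  using U_dom c_nz by (auto simp: Ppoly_def)

lemma sum_F:
  assumes i: "i < m" and x: "x \<in> U"
  shows "(\<Sum>s\<in>UNIV. fps_const (w x s) * (1 * inverse (q i s x)))
     = fps_X ^ k i * (fps_const (-4 * c) * Pt i) * inverse (F i x) ^ 2 - L"
  unfolding q_def
proof (rule fps_sqrt_branch.weighted_inverse_sum[OF branch_F[OF i] x])
  have "pcompose [:- mu s, 1:] [:mu i, 1:] = [:mu i - mu s, 1:]" for s
    by (simp add: pcompose_pCons)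
  then have "pcompose Pp [:mu i, 1:] = smult (-4 * c) (\<Prod>s<m. [:mu i - mu s, 1:] ^ k s)"
    by (simp add: Pp_def pcompose_smult pcompose_uminus pcompose_prod pcompose_power)
  also have "(\<Prod>s<m. [:mu i - mu s, 1:] ^ k s) = [:0, 1:] ^ k i * (\<Prod>s\<in>{..<m} - {i}. [:mu i - mu s, 1:] ^ k s)"
    using i by (subst prod.remove[of _ i]) auto
  finally have "fps_X ^ k i * (fps_const (-4 * c) * Pt i) = fps_of_poly (pcompose Pp [:mu i, 1:])"
    by (simp only: fps_of_poly_smult fps_of_poly_mult fps_of_poly_prod fps_of_poly_power
        fps_of_poly_linear Pt_def fps_const_0_eq_0 add_0_right mult_ac)
  also note lagrange_interpolation_shift[OF degree_Pp inj_coords[OF x], unfolded poly_Pp]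
  finally show "fps_X ^ k i * (fps_const (-4 * c) * Pt i)
    = L * (\<Prod>s\<in>UNIV. fps_X + fps_const (mu i) + fps_const (x $ s) * (-1))
     + (\<Sum>s\<in>UNIV. fps_const (w x s) * (1 * (\<Prod>j\<in>UNIV - {s}. fps_X + fps_const (mu i) + fps_const (x $ j) * (-1))))"
    unfolding L_def w_def .
qed

lemma sum_Finf:
  assumes x: "x \<in> U"
  shows "(\<Sum>s\<in>UNIV. fps_const (w x s) * (fps_X * inverse (qinf s x)))
     = fps_X ^ d * (fps_const (-4 * c) * R) * inverse (Finf x) ^ 2 - L"
  unfolding qinf_def
proof (rule fps_sqrt_branch.weighted_inverse_sum[OF branch_Finf x])
  \<comment> \<open>This is \<open>P\<close> reversed at degree \<open>n\<close>. As
    \<open>P\<close> has degree \<open>n - d\<close>, the reversal has a zero of order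
    \<open>d\<close> at 0.\<close>
  define r where "r = [:0, 1:] ^ d * smult (-4 * c) (\<Prod>i<m. [:1, - mu i:] ^ k i)"
  have r: "poly r t = t ^ CARD('n) * poly Pp (1 / t)" if t: "t \<noteq> 0" for t
  proof -
    have "t ^ CARD('n) = t ^ d * t ^ (\<Sum>i<m. k i)"
      using k_sum by (simp add: d_def flip: power_add)
    also have "t ^ (\<Sum>i<m. k i) = (\<Prod>i<m. t ^ k i)" by (simp add: power_sum)
    finally have "t ^ CARD('n) * poly Pp (1 / t) = t ^ d * (-4 * c) * (\<Prod>i<m. t ^ k i * (1 / t - mu i) ^ k i)"
      by (simp add: poly_Pp Ppoly_def prod.distrib)
    also have "\<dots> = t ^ d * (-4 * c) * (\<Prod>i<m. (1 - t * mu i) ^ k i)"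
      using t by (simp add: right_diff_distrib flip: power_mult_distrib)
    finally show ?thesis by (simp add: r_def poly_prod)
  qed
  have "fps_X ^ d * (fps_const (-4 * c) * R) = fps_of_poly r"
    by (simp only: r_def R_def fps_of_poly_smult fps_of_poly_mult fps_of_poly_prod fps_of_poly_power
        fps_of_poly_linear' fps_of_poly_fps_X)
  also note lagrange_interpolation_reflect[OF degree_Pp inj_coords[OF x] r, unfolded poly_Pp]
  finally show "fps_X ^ d * (fps_const (-4 * c) * R)
    = L * (\<Prod>s\<in>UNIV. 1 + fps_const (x $ s) * (- fps_X))
     + (\<Sum>s\<in>UNIV. fps_const (w x s) * (fps_X * (\<Prod>j\<in>UNIV - {s}. 1 + fps_const (x $ j) * (- fps_X))))"
    unfolding L_def w_def .
qed

lemma q_nz: "i < m \<Longrightarrow> x \<in> U \<Longrightarrow> fps_nth (q i s x) 0 \<noteq> 0"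
  using U_dom by (simp add: q_def) metis

lemma qinf_nz: "fps_nth (qinf s x) 0 \<noteq> 0"
  by (simp add: qinf_def)

lemma F_nz: "i < m \<Longrightarrow> x \<in> U \<Longrightarrow> fps_nth (F i x) 0 \<noteq> 0"
  using fps_sqrt_branch.const_term_nz[OF branch_F] by blast

lemma Finf_nz: "x \<in> U \<Longrightarrow> fps_nth (Finf x) 0 \<noteq> 0"
  using fps_sqrt_branch.const_term_nz[OF branch_Finf] by blast

lemma lift_L: "fps_lift L = fps_const L"
  by (simp add: L_def fps_lift_const)

section \<open>The entries of the Gram matrix\<close>

lemma gstar_weighted:
  assumes "\<And>s. partial s f x = - (1/2) * fps_nth (G * b s) a" "\<And>s. partial s g x = - (1/2) * fps_nth (H * b' s) a'"
  shows "gstar P x f g = (1/4) * (\<Sum>s\<in>UNIV. w x s * fps_nth (G * b s) a * fps_nth (H * b' s) a')"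
  unfolding gstar_diagonal assms w_def sum_distrib_left by (intro sum.cong refl) simp

lemma gstar_Fin_Fin_neq:
  assumes x: "x \<in> U" and i: "i < m" "a < k i" and j: "j < m" "b < k j" and "i \<noteq> j"
  shows "gstar P x (Y (Fin i a)) (Y (Fin j b)) = 0"
proof -
  \<comment> \<open>This is \<open>\<tau> - t\<close> for \<open>\<tau>\<close> near
    \<open>mu j\<close> and \<open>t\<close> near \<open>mu i\<close>; its constant term is
    \<open>mu j - mu i\<close>.\<close>
  define D where "D = (fps_X + fps_const (fps_const (mu j))) - fps_const (fps_X + fps_const (mu i))"
  have "(\<Sum>s\<in>UNIV. w x s * fps_nth (F i x * inverse (q i s x)) a * fps_nth (F j x * inverse (q j s x)) b) = 0"
  proof (rule partial_fraction_cross_coeff[OF F_nz[OF i(1) x] F_nz[OF j(1) x] _ sum_F[OF i(1) x]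
        sum_F[OF j(1) x] lift_L _ i(2) j(2)])
    fix s
    have "fps_const 1 * fps_lift (q j s x) - fps_lift 1 * fps_const (q i s x) = D"
      by (simp add: D_def q_def fps_lift_add fps_lift_mult fps_lift_X fps_lift_const fps_lift_1
          flip: fps_const_add)
    then show "fps_const (1 * inverse (q i s x)) - fps_lift (1 * inverse (q j s x))
       = D * fps_const (inverse (q i s x)) * fps_lift (inverse (q j s x))"
      using inverse_split[OF q_nz[OF i(1) x] q_nz[OF j(1) x], of 1 s 1 s] by simp
    show "fps_nth (fps_nth D 0) 0 \<noteq> 0" using mu_distinct i j \<open>i \<noteq> j\<close> by (auto simp: D_def)
  qed
  then show ?thesis
    by (subst gstar_weighted[OF partial_Fin[OF i(1) x] partial_Fin[OF j(1) x]]) simp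
qed

lemma gstar_Fin_Inf:
  assumes x: "x \<in> U" and i: "i < m" "a < k i" and b: "1 \<le> b" "b \<le> d"
  shows "gstar P x (Y (Fin i a)) (Y (Inf b)) = 0"
proof -
  \<comment> \<open>With \<open>v = 1 / \<tau>\<close> this is \<open>v * (\<tau> - t)\<close>, the
    difference rescaled so as to be regular at infinity; its constant term is 1.\<close>
  define D where "D = 1 - fps_X * fps_const (fps_X + fps_const (mu i))"
  have "b - 1 < d" using b by simp
  have "(\<Sum>s\<in>UNIV. w x s * fps_nth (F i x * inverse (q i s x)) a * fps_nth (Finf x * inverse (qinf s x)) (b - 1)) = 0"
  proof (rule partial_fraction_cross_coeff[OF F_nz[OF i(1) x] Finf_nz[OF x] _ sum_F[OF i(1) x]
        sum_Finf[OF x] lift_L _ i(2) \<open>b - 1 < d\<close>])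
    fix s
    have "fps_const 1 * fps_lift (qinf s x) - fps_lift fps_X * fps_const (q i s x) = D"
      by (simp add: D_def q_def qinf_def fps_lift_diff fps_lift_mult fps_lift_X fps_lift_const fps_lift_1
          algebra_simps flip: fps_const_add fps_const_sub)
    then show "fps_const (1 * inverse (q i s x)) - fps_lift (fps_X * inverse (qinf s x))
       = D * fps_const (inverse (q i s x)) * fps_lift (inverse (qinf s x))"
      using inverse_split[OF q_nz[OF i(1) x] qinf_nz, of 1 s fps_X s x] by simp
    show "fps_nth (fps_nth D 0) 0 \<noteq> 0" by (simp add: D_def)
  qed
  then show ?thesis
    by (subst gstar_weighted[OF partial_Fin[OF i(1) x] partial_Inf[OF b(1) x]]) simp
qed

lemma Ptil_eq: "Ptil mu k m i j = (if j < 0 then 0 else fps_nth (Pt i) (nat j))"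
proof -
  have "(\<lambda>t. \<Prod>s\<in>{..<m} - {i}. (mu i + t - mu s) ^ k s) has_fps_expansion
      (\<Prod>s\<in>{..<m} - {i}. (fps_const (mu i) + fps_X - fps_const (mu s)) ^ k s)"
    by (intro fps_expansion_intros)
  also have "(\<Prod>s\<in>{..<m} - {i}. (fps_const (mu i) + fps_X - fps_const (mu s)) ^ k s) = Pt i"
    unfolding Pt_def by (simp add: algebra_simps flip: fps_const_sub)
  finally show ?thesis unfolding Ptil_def by (rule tcoef_eq_fps_nth)
qed

lemma Rco_eq: "Rco mu k m j = (if j < 0 then 0 else fps_nth R (nat j))"
proof -
  have "(\<lambda>t. \<Prod>i<m. (1 - (0 + t) * mu i) ^ k i) has_fps_expansion (\<Prod>i<m. (1 - (0 + fps_X) * fps_const (mu i)) ^ k i)"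
    by (intro fps_expansion_intros)
  also have "(\<Prod>i<m. (1 - (0 + fps_X) * fps_const (mu i)) ^ k i) = R"
    unfolding R_def by (simp add: mult.commute flip: fps_const_neg)
  finally show ?thesis unfolding Rco_def by (rule tcoef_eq_fps_nth)
qed

lemma gstar_Fin_Fin:
  assumes x: "x \<in> U" and i: "i < m" and a: "a < k i" and b: "b < k i"
  shows "gstar P x (Y (Fin i a)) (Y (Fin i b)) = c * Ptil mu k m i (int a + int b - int (k i) + 1)"
proof -
  have "1 * (\<Sum>s\<in>UNIV. w x s * fps_nth (F i x * inverse (q i s x)) a * fps_nth (F i x * inverse (q i s x)) b)
      = - fps_nth (fps_X ^ k i * (fps_const (-4 * c) * Pt i)) (a + b + 1)"
  proof (rule partial_fraction_diag_coeff[OF F_nz[OF i x] _ sum_F[OF i x] lift_L a b])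
    fix s
    have "fps_const 1 * fps_lift (q i s x) - fps_lift 1 * fps_const (q i s x)
       = fps_const (fps_const 1) * (fps_X - fps_const fps_X)"
      by (simp add: q_def fps_lift_add fps_lift_mult fps_lift_X fps_lift_const fps_lift_1
          flip: fps_const_add)
    then show "fps_const (1 * inverse (q i s x)) - fps_lift (1 * inverse (q i s x))
       = fps_const (fps_const 1) * (fps_X - fps_const fps_X) * fps_const (inverse (q i s x)) * fps_lift (inverse (q i s x))"
      using inverse_split[OF q_nz[OF i x] q_nz[OF i x], of 1 s 1 s] by simp
  qed
  \<comment> \<open>Both sides truncate at 0. If \<open>a + b + 1 < k i\<close>, the Gram entry
    vanishes by the convention for negative indices and the series coefficient vanishes because of
    \<open>fps_X ^ k i\<close>.\<close>
  moreover have "nat (int a + int b - int (k i) + 1) = a + b + 1 - k i" by simp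
  ultimately show ?thesis
    by (subst gstar_weighted[OF partial_Fin[OF i x] partial_Fin[OF i x]])
      (auto simp: Ptil_eq fps_X_power_mult_nth)
qed

lemma gstar_Inf_Inf:
  assumes x: "x \<in> U" and a: "1 \<le> a" "a \<le> d" and b: "1 \<le> b" "b \<le> d"
  shows "gstar P x (Y (Inf a)) (Y (Inf b)) = - c * Rco mu k m (int a + int b - int d - 1)"
proof -
  have "a - 1 < d" "b - 1 < d" using a b by auto
  \<comment> \<open>The leading \<open>-1\<close> is \<open>\<epsilon>\<close>:
    \<open>u / (1 - u x) - v / (1 - v x)\<close> has numerator \<open>u - v\<close>, whereas at a
    finite point the numerator is \<open>v - u\<close>. Hence the opposite sign of the block at
    infinity.\<close>
  have "-1 * (\<Sum>s\<in>UNIV. w x s * fps_nth (Finf x * inverse (qinf s x)) (a - 1) * fps_nth (Finf x * inverse (qinf s x)) (b - 1))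
      = - fps_nth (fps_X ^ d * (fps_const (-4 * c) * R)) ((a - 1) + (b - 1) + 1)"
  proof (rule partial_fraction_diag_coeff[OF Finf_nz[OF x] _ sum_Finf[OF x] lift_L \<open>a - 1 < d\<close> \<open>b - 1 < d\<close>])
    fix s
    have "fps_const fps_X * fps_lift (qinf s x) - fps_lift fps_X * fps_const (qinf s x)
       = fps_const (fps_const (-1)) * (fps_X - fps_const fps_X)"
      by (simp add: qinf_def fps_lift_diff fps_lift_mult fps_lift_X fps_lift_const fps_lift_1
          algebra_simps flip: fps_const_sub)
    then show "fps_const (fps_X * inverse (qinf s x)) - fps_lift (fps_X * inverse (qinf s x))
       = fps_const (fps_const (-1)) * (fps_X - fps_const fps_X) * fps_const (inverse (qinf s x)) * fps_lift (inverse (qinf s x))"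
      using inverse_split[OF qinf_nz qinf_nz, of fps_X s x fps_X s x] by simp
  qed
  moreover have "nat (int a + int b - int d - 1) = (a - 1) + (b - 1) + 1 - d" using a b by simp
  ultimately show ?thesis
    by (subst gstar_weighted[OF partial_Inf[OF a(1) x] partial_Inf[OF b(1) x]])
      (use a b in \<open>auto simp: Rco_eq fps_X_power_mult_nth\<close>)
qed

lemma gstar_commute: "gstar P x f g = gstar P x g f"
  unfolding gstar_diagonal by (simp add: mult_ac)

lemma gstar_eq_Gram:
  assumes "x \<in> U" "A \<in> fidx_set k m d" "B \<in> fidx_set k m d"
  shows "gstar P x (Y A) (Y B) = Gram c mu k m d A B"
proof (cases A)
  case A: (Fin i a)
  then have i: "i < m" "a < k i" using assms(2) by (auto simp: fidx_set_def)
  show ?thesis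
  proof (cases B)
    case B: (Fin j b)
    then have j: "j < m" "b < k j" using assms(3) by (auto simp: fidx_set_def)
    show ?thesis
    proof (cases "i = j")
      case True
      then show ?thesis
        using gstar_Fin_Fin[OF assms(1) i(1), of a b] i j unfolding A B by simp
    next
      case False
      then show ?thesis
        using gstar_Fin_Fin_neq[OF assms(1) i j] unfolding A B by simp
    qed
  next
    case B: (Inf b)
    then have "1 \<le> b" "b \<le> d" using assms(3) by (auto simp: fidx_set_def)
    from gstar_Fin_Inf[OF assms(1) i this] show ?thesis unfolding A B by simp
  qed
next
  case A: (Inf a)
  then have a: "1 \<le> a" "a \<le> d" using assms(2) by (auto simp: fidx_set_def)
  show ?thesis
  proof (cases B)
    case B: (Fin j b)
    then have "j < m" "b < k j" using assms(3) by (auto simp: fidx_set_def)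
    from gstar_Fin_Inf[OF assms(1) this a] show ?thesis
      unfolding A B by (subst gstar_commute) simp
  next
    case B: (Inf b)
    then have "1 \<le> b" "b \<le> d" using assms(3) by (auto simp: fidx_set_def)
    from gstar_Inf_Inf[OF assms(1) a this] show ?thesis unfolding A B by simp
  qed
qed

section \<open>Flatness and functional independence\<close>

lemma card_idx: "card (fidx_set k m d) = CARD('n)"
  using k_sum by (simp add: card_fidx_set d_def)

lemma Y_differentiable:
  assumes "A \<in> fidx_set k m d" "x \<in> U"
  shows "Y A differentiable (at x)"
    and "partial b (Y A) differentiable (at x)"
    and "partial a (partial b (Y A)) x = partial b (partial a (Y A)) x"
proof -
  have *: "Y A differentiable (at x) \<and> partial b (Y A) differentiable (at x)
    \<and> partial a (partial b (Y A)) x = partial b (partial a (Y A)) x"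
  proof (cases A)
    case (Fin i l)
    with assms have "i < m" by (auto simp: fidx_set_def)
    note br = branch_F[OF this]
    show ?thesis unfolding Fin Y_Fin
      using fps_sqrt_branch.coeff_differentiable[OF br assms(2)]
        fps_sqrt_branch.partial_coeff_differentiable[OF br assms(2)]
        fps_sqrt_branch.partial_coeff_commute[OF br assms(2)] by blast
  next
    case (Inf l)
    show ?thesis unfolding Inf Y_Inf
      using fps_sqrt_branch.coeff_differentiable[OF branch_Finf assms(2)]
        fps_sqrt_branch.partial_coeff_differentiable[OF branch_Finf assms(2)]
        fps_sqrt_branch.partial_coeff_commute[OF branch_Finf assms(2)] by blast
  qed
  then show "Y A differentiable (at x)" "partial b (Y A) differentiable (at x)"
    "partial a (partial b (Y A)) x = partial b (partial a (Y A)) x" by blast+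
qed

lemma Gram_nondegenerate: "nondegenerate_on (fidx_set k m d) (Gram c mu k m d)"
  by (rule nondegenerate_Gram[OF c_nz mu_distinct])

lemma hess_Y:
  assumes "A \<in> fidx_set k m d" "x \<in> U"
  shows "hess P (Y A) x a b = 0"
  by (rule hess_zero_if_gram_const[OF card_idx U_open assms(2) P_nz _ gstar_eq_Gram Gram_nondegenerate
        Y_differentiable(2) Y_differentiable(3) assms(1)]) (use U_dom assms(2) in auto)

text \<open>Pairing a linear relation among the differentials with each \<open>dY_B\<close> under
  \<open>g^*\<close> gives a kernel vector of the Gram matrix, which is nondegenerate.\<close>

lemma differentials_independent:
  assumes x: "x \<in> U" and v: "\<And>s. (\<Sum>A\<in>fidx_set k m d. v A * partial s (Y A) x) = 0"
    and A: "A \<in> fidx_set k m d"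
  shows "v A = 0"
proof -
  let ?I = "fidx_set k m d"
  have "(\<Sum>A\<in>?I. v A * Gram c mu k m d A B) = 0" if B: "B \<in> ?I" for B
  proof -
    have "(\<Sum>A\<in>?I. v A * Gram c mu k m d A B) = (\<Sum>A\<in>?I. v A * gstar P x (Y A) (Y B))"
      using gstar_eq_Gram[OF x _ B] by (intro sum.cong) auto
    also have "\<dots> = (\<Sum>A\<in>?I. \<Sum>s\<in>UNIV. w x s * partial s (Y B) x * (v A * partial s (Y A) x))"
      by (simp add: gstar_diagonal w_def sum_distrib_left mult_ac)
    also have "\<dots> = (\<Sum>s\<in>UNIV. w x s * partial s (Y B) x * (\<Sum>A\<in>?I. v A * partial s (Y A) x))"
      by (subst sum.swap) (simp add: sum_distrib_left)
    finally show ?thesis by (simp add: v)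
  qed
  with Gram_nondegenerate A show ?thesis unfolding nondegenerate_on_def by blast
qed

end

theorem theorem1p5:
  fixes c :: complex and mu :: "nat \<Rightarrow> complex" and k :: "nat \<Rightarrow> nat" and m d :: nat
    and U :: "(complex^'n) set"
    and S :: "nat \<Rightarrow> complex \<Rightarrow> complex^'n \<Rightarrow> complex"
    and Sinf :: "complex \<Rightarrow> complex^'n \<Rightarrow> complex"
  assumes c_nz: "c \<noteq> 0"
    and mu_distinct: "\<forall>i<m. \<forall>j<m. i \<noteq> j \<longrightarrow> mu i \<noteq> mu j"
    and k_pos: "\<forall>i<m. 1 \<le> k i"
    and k_sum: "(\<Sum>i<m. k i) \<le> CARD('n)"
    and d_def: "d = CARD('n) - (\<Sum>i<m. k i)"
    and U_open: "open U"
    and U_dom: "\<forall>x\<in>U. (\<forall>s t. s \<noteq> t \<longrightarrow> x $ s \<noteq> x $ t) \<and> (\<forall>s. \<forall>i<m. x $ s \<noteq> mu i)"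
    and S_branch: "\<forall>i<m. \<forall>x\<in>U. \<exists>r>0. (\<lambda>t. S i t x) holomorphic_on ball (mu i) r \<and>
        (\<forall>t\<in>ball (mu i) r. (S i t x)^2 = det (mat t - Lmat x))"
    and S_cont: "\<forall>i<m. continuous_on U (\<lambda>x. S i (mu i) x)"
    and Sinf_branch: "\<forall>x\<in>U. \<exists>r>0. (\<lambda>t. Sinf t x) holomorphic_on ball 0 r \<and>
        (\<forall>t\<in>ball 0 r. (Sinf t x)^2 = det (mat 1 - mat t ** Lmat x))"
    and Sinf_cont: "continuous_on U (\<lambda>x. Sinf 0 x)"
  shows
    "card (fidx_set k m d) = CARD('n)
     \<and> (\<forall>A\<in>fidx_set k m d. \<forall>x\<in>U.
          Yfun mu k m S Sinf A differentiable (at x)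
          \<and> (\<forall>b. partial b (Yfun mu k m S Sinf A) differentiable (at x))
          \<and> (\<forall>a b. hess (Ppoly c mu k m) (Yfun mu k m S Sinf A) x a b = 0))
     \<and> (\<forall>x\<in>U. \<forall>i<m. \<forall>j<m. \<forall>a<k i. \<forall>b<k j. i \<noteq> j \<longrightarrow>
          gstar (Ppoly c mu k m) x (Yfun mu k m S Sinf (Fin i a)) (Yfun mu k m S Sinf (Fin j b)) = 0)
     \<and> (\<forall>x\<in>U. \<forall>i<m. \<forall>a<k i. \<forall>b<k i.
          gstar (Ppoly c mu k m) x (Yfun mu k m S Sinf (Fin i a)) (Yfun mu k m S Sinf (Fin i b))
            = c * Ptil mu k m i (int a + int b - int (k i) + 1))
     \<and> (\<forall>x\<in>U. \<forall>i<m. \<forall>a<k i. \<forall>b. 1 \<le> b \<and> b \<le> d \<longrightarrow>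
          gstar (Ppoly c mu k m) x (Yfun mu k m S Sinf (Fin i a)) (Yfun mu k m S Sinf (Inf b)) = 0)
     \<and> (\<forall>x\<in>U. \<forall>a b. 1 \<le> a \<and> a \<le> d \<and> 1 \<le> b \<and> b \<le> d \<longrightarrow>
          gstar (Ppoly c mu k m) x (Yfun mu k m S Sinf (Inf a)) (Yfun mu k m S Sinf (Inf b))
            = - c * Rco mu k m (int a + int b - int d - 1))
     \<and> nondegenerate_on (fidx_set k m d) (Gram c mu k m d)
     \<and> (\<forall>x\<in>U. \<forall>v. (\<forall>s. (\<Sum>A\<in>fidx_set k m d. v A * partial s (Yfun mu k m S Sinf A) x) = 0)
          \<longrightarrow> (\<forall>A\<in>fidx_set k m d. v A = 0))"
proof -
  interpret flat_coordinates c mu k m d U S Sinf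
    by unfold_locales (fact c_nz mu_distinct k_pos k_sum d_def U_open U_dom S_branch S_cont Sinf_branch Sinf_cont)+
  show ?thesis
    using card_idx Y_differentiable hess_Y gstar_Fin_Fin_neq gstar_Fin_Fin gstar_Fin_Inf gstar_Inf_Inf
      Gram_nondegenerate differentials_independent
    by (intro conjI allI ballI impI) (simp_all del: Yfun.simps)
qed

end
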